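(* Let $(S,d_S)$ be a Polish space, let $\mathcal{L}^o$ be the space of loops on $S$ equipped with the metric $D^o$ and its Borel $\sigma$-field, let $n\ge1$, and let $f:S^n\to\mathbb{R}$ be a bounded Borel measurable function. Then the map $\mathcal{L}^o\to\mathbb{R}$, $l\mapsto\langle l,f\rangle$, is Borel measurable.
   Context: $(S,d_S)$ is a Polish space (a complete separable metric space) with its Borel $\sigma$-field. For $a>0$, $D_S([0,a])$ is the set of paths $[0,a]\to S$ that are right-continuous with left limits and, in addition, left-continuous at time $a$. Based loop: an element $l\in D_S([0,t])$ for some $t>0$ with $l(0)=l(t)$; $|l|:=t$ is its duration. For a based loop $l$ of duration $t$ and $r\in[0,t)$, the circular translation $\Theta_r l:[0,t]\to S$ is $\Theta_r l(u)=l(u+r)$ for $u\in[0,t-r]$ and $\Theta_r l(u)=l(u+r-t)$ for $u\in[t-r,t]$. Loop: two based loops $l,l'$ are equivalent iff $|l|=|l'|$ and $l'=\Theta_r l$ for some $r\in[0,|l|)$. A loop is an equivalence class of based loops; $l^o$ denotes the class of $l$, and $\mathcal{L}^o$ the set of loops. Metric: for a based loop $l$ let $l^{\mathrm{normalized}}(u)=l(|l|u)$, $u\in[0,1]$. For $l_1,l_2\in D_S([0,1])$, $$d(l_1,l_2)=\inf_\lambda\Big(\sup_{0\le s<t\le1}\Big|\log\tfrac{\lambda(t)-\lambda(s)}{t-s}\Big|+\sup_{u\in[0,1]}d_S(l_1(\lambda(u)),l_2(u))\Big),$$ the infimum being over all increasing bijections $\lambda:[0,1]\to[0,1]$. For based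 loops, $D(l_1,l_2)=\big||l_1|-|l_2|\big|+d(l_1^{\mathrm{normalized}},l_2^{\mathrm{normalized}})$. For loops, $D^o(l_1^o,l_2^o)=\inf\{D(l,l'):l\in l_1^o,\ l'\in l_2^o\}$; this is a metric on $\mathcal{L}^o$. Multi-occupation field: let $r_j(z^1,\ldots,z^n)=(z^{1+j},\ldots,z^n,z^1,\ldots,z^j)$ for $0\le j\le n-1$. For a based loop $l$ of duration $t$, $$\langle l,f\rangle=\sum_{j=0}^{n-1}\int_{0<s^1<\cdots<s^n<t}f\circ r_j(l(s^1),\ldots,l(s^n))\,ds^1\cdots ds^n.$$ This value is the same for equivalent based loops, so $\langle l^o,f\rangle:=\langle l,f\rangle$ is well defined on loops. *)

theory Defs
  imports "HOL-Analysis.Analysis"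
begin

section \<open>Topologies and Borel \<open>\<sigma>\<close>-fields\<close>

definition borel_of :: "'a topology \<Rightarrow> 'a measure" where
  "borel_of T = sigma (topspace T) {U. openin T U}"

text \<open>
  This is \<open>Metric_space.mtopology\<close>, whose defining equations are only available once \<open>d\<close> is
  known to be a metric on \<open>M\<close>. The family of sets below is a topology for every \<open>d\<close>.
\<close>

definition dist_topology :: "'a set \<Rightarrow> ('a \<Rightarrow> 'a \<Rightarrow> real) \<Rightarrow> 'a topology" where
  "dist_topology M d =
     topology (\<lambda>U. U \<subseteq> M \<and> (\<forall>x\<in>U. \<exists>r>0. {y \<in> M. d x y < r} \<subseteq> U))"

lemma openin_dist_topology:
  "openin (dist_topology M d) U \<longleftrightarrow> U \<subseteq> M \<and> (\<forall>x\<in>U. \<exists>r>0. {y \<in> M. d x y < r} \<subseteq> U)"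
proof -
  let ?P = "\<lambda>U. U \<subseteq> M \<and> (\<forall>x\<in>U. \<exists>r>0. {y \<in> M. d x y < r} \<subseteq> U)"
  have "?P (A \<inter> B)" if A: "?P A" and B: "?P B" for A B
  proof (intro conjI ballI)
    show "A \<inter> B \<subseteq> M" using A by blast
    fix x assume "x \<in> A \<inter> B"
    then obtain r s where "r > 0" "{y \<in> M. d x y < r} \<subseteq> A" "s > 0" "{y \<in> M. d x y < s} \<subseteq> B"
      using A B by (meson IntD1 IntD2)
    then show "\<exists>r>0. {y \<in> M. d x y < r} \<subseteq> A \<inter> B"
      by (intro exI[of _ "min r s"]) auto
  qed
  moreover have "?P (\<Union>\<K>)" if K: "\<forall>K\<in>\<K>. ?P K" for \<K>
  proof (intro conjI ballI)
    show "\<Union>\<K> \<subseteq> M" using K by blast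
    fix x assume "x \<in> \<Union>\<K>"
    then obtain A where "A \<in> \<K>" "x \<in> A" by blast
    moreover from this K obtain r where "r > 0" "{y \<in> M. d x y < r} \<subseteq> A" by meson
    ultimately show "\<exists>r>0. {y \<in> M. d x y < r} \<subseteq> \<Union>\<K>" by blast
  qed
  ultimately have "istopology ?P"
    unfolding istopology_def by presburger
  then show ?thesis
    by (simp add: dist_topology_def topology_inverse')
qed

lemma topspace_dist_topology: "topspace (dist_topology M d) = M"
proof (rule antisym)
  show "topspace (dist_topology M d) \<subseteq> M"
    by (metis openin_dist_topology openin_topspace)
  have "openin (dist_topology M d) M"
    unfolding openin_dist_topology using zero_less_one by blast
  then show "M \<subseteq> topspace (dist_topology M d)"
    by (rule openin_subset)
qed

lemma dist_topology_eq_mtopology: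
  assumes "Metric_space M d"
  shows "dist_topology M d = Metric_space.mtopology M d"
proof -
  interpret Metric_space M d by fact
  have "{y \<in> M. d x y < r} = mball x r" if "x \<in> M" for x r
    using that by auto
  then show ?thesis
    unfolding topology_eq openin_dist_topology openin_mtopology
    by (metis subsetD)
qed


section \<open>Based loops and loops\<close>

text \<open>
  Paths on \<open>[0,a]\<close> are functions on the reals that are \<open>undefined\<close> outside \<open>[0,a]\<close>, so that
  equality of paths is equality of functions.
\<close>

definition path_space :: "real \<Rightarrow> (real \<Rightarrow> 'a::topological_space) set" where
  "path_space a = {l \<in> extensional {0..a}.
     (\<forall>u\<in>{0..<a}. (l \<longlongrightarrow> l u) (at_right u)) \<and>
     (\<forall>u\<in>{0<..a}. \<exists>x. (l \<longlongrightarrow> x) (at_left u)) \<and>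
     (l \<longlongrightarrow> l a) (at_left a)}"

text \<open>A based loop is a pair consisting of its duration and its path.\<close>

type_synonym 'a timed_path = "real \<times> (real \<Rightarrow> 'a)"

definition based_loops :: "'a::topological_space timed_path set" where
  "based_loops = {(t, l). t > 0 \<and> l \<in> path_space t \<and> l 0 = l t}"

definition circ_shift :: "real \<Rightarrow> 'a timed_path \<Rightarrow> 'a timed_path" where
  "circ_shift r = (\<lambda>(t, l).
     (t, \<lambda>u\<in>{0..t}. if u \<le> t - r then l (u + r) else l (u + r - t)))"

text \<open>
  Membership of \<open>l'\<close> in \<open>based_loops\<close> is a genuine restriction: if \<open>l\<close> jumps at \<open>r\<close>, then
  \<open>circ_shift r l\<close> is not left-continuous at its final time and hence not a based loop.
\<close>

definition loop_rel :: "('a::topological_space timed_path \<times> 'a timed_path) set" where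
  "loop_rel = {(l, l'). l \<in> based_loops \<and> l' \<in> based_loops \<and> fst l = fst l' \<and>
     (\<exists>r\<in>{0..<fst l}. l' = circ_shift r l)}"

lemma circ_shift_0:
  assumes "l \<in> based_loops"
  shows "circ_shift 0 l = l"
proof -
  obtain t p where l: "l = (t,p)" by force
  have e: "p \<in> extensional {0..t}" using assms l by (auto simp: based_loops_def path_space_def)
  have "restrict p {0..t} = p" using e by (rule extensional_restrict)
  moreover have "(\<lambda>u\<in>{0..t}. if u \<le> t - 0 then p (u + 0) else p (u + 0 - t)) = restrict p {0..t}"
    by (rule restrict_ext) auto
  ultimately show ?thesis by (simp only: l circ_shift_def case_prod_conv)
qed

lemma circ_shift_circ_shift:
  assumes "l \<in> based_loops" "r \<in> {0..<fst l}" "q \<in> {0..<fst l}"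
  shows "circ_shift q (circ_shift r l) = circ_shift (if r + q < fst l then r + q else r + q - fst l) l"
proof -
  obtain t p where l: "l = (t,p)" by force
  have r: "0 \<le> r" "r < t" "0 \<le> q" "q < t" using assms l by auto
  have e: "p 0 = p t" using assms l by (auto simp: based_loops_def)
  have eq: "p x = p y" if "x = y \<or> x = t \<and> y = 0 \<or> y = t \<and> x = 0" for x y
    using that e by auto
  let ?m = "if r + q < t then r + q else r + q - t"
  let ?c = "\<lambda>r p. \<lambda>u\<in>{0..t}. if u \<le> t - r then p (u + r) else p (u + r - t)"
  have "?c q (?c r p) = ?c ?m p"
  proof (rule restrict_ext)
    fix u assume u: "u \<in> {0..t}"
    define a where "a = (if u \<le> t - q then u + q else u + q - t)"
    have a: "a \<in> {0..t}" using u r by (auto simp: a_def)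
    have "(if u \<le> t - q then ?c r p (u + q) else ?c r p (u + q - t)) = ?c r p a"
      by (simp add: a_def)
    also have "\<dots> = p (if a \<le> t - r then a + r else a + r - t)"
      using a by (simp add: restrict_def)
    also have "\<dots> = p (if u \<le> t - ?m then u + ?m else u + ?m - t)"
      by (rule eq) (use u r in \<open>auto simp: a_def\<close>)
    finally show "(if u \<le> t - q then ?c r p (u + q) else ?c r p (u + q - t)) =
        (if u \<le> t - ?m then p (u + ?m) else p (u + ?m - t))"
      by (simp split: if_splits)
  qed
  then show ?thesis by (simp only: l circ_shift_def case_prod_conv fst_conv)
qed

lemma equiv_loop_rel:
  "equiv (based_loops :: 'a::topological_space timed_path set) loop_rel"
proof (rule equivI)
  show "(loop_rel :: ('a timed_path \<times> _) set) \<subseteq> based_loops \<times> based_loops" by (auto simp: loop_rel_def)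
  have pos: "fst l > 0" if "l \<in> based_loops" for l :: "'a timed_path" using that by (auto simp: based_loops_def)
  show "refl_on (based_loops :: 'a timed_path set) loop_rel"
  proof (rule refl_onI)
    fix l :: "'a timed_path" assume l: "l \<in> based_loops"
    have "0 \<in> {0..<fst l}" using pos[OF l] by simp
    moreover have "l = circ_shift 0 l" using circ_shift_0[OF l] by (rule sym)
    ultimately show "(l, l) \<in> loop_rel" unfolding loop_rel_def using l by blast
  qed
  show "sym (loop_rel :: ('a timed_path \<times> _) set)"
  proof (rule symI)
    fix l l' :: "'a timed_path" assume A: "(l, l') \<in> loop_rel"
    then obtain r where r: "l \<in> based_loops" "l' \<in> based_loops" "fst l = fst l'" "r \<in> {0..<fst l}" "l' = circ_shift r l"
      by (auto simp: loop_rel_def)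
    define q where "q = (if r = 0 then 0 else fst l - r)"
    have q: "q \<in> {0..<fst l}" using r by (auto simp: q_def)
    have "circ_shift q l' = circ_shift 0 l"
      unfolding r(5) by (subst circ_shift_circ_shift) (use r q pos[OF r(1)] in \<open>auto simp: q_def\<close>)
    then have "l = circ_shift q l'" by (simp add: circ_shift_0[OF r(1)])
    moreover have "q \<in> {0..<fst l'}" using q r(3) by simp
    ultimately have "\<exists>q\<in>{0..<fst l'}. l = circ_shift q l'" by (rule bexI)
    then show "(l', l) \<in> loop_rel" using r(1-3) unfolding loop_rel_def by simp
  qed
  show "trans (loop_rel :: ('a timed_path \<times> _) set)"
  proof (rule transI)
    fix l l' l'' :: "'a timed_path" assume A: "(l, l') \<in> loop_rel" "(l', l'') \<in> loop_rel"
    then obtain r q where r: "l \<in> based_loops" "l'' \<in> based_loops" "r \<in> {0..<fst l}" "l' = circ_shift r l"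
       "q \<in> {0..<fst l}" "l'' = circ_shift q l'" "fst l'' = fst l" by (auto simp: loop_rel_def)
    define m where "m = (if r + q < fst l then r + q else r + q - fst l)"
    have "m \<in> {0..<fst l}" using r by (auto simp: m_def)
    moreover have "l'' = circ_shift m l" unfolding r(6) r(4) m_def using r by (intro circ_shift_circ_shift)
    ultimately show "(l, l'') \<in> loop_rel" using r unfolding loop_rel_def by auto
  qed
qed

definition loops :: "'a::topological_space timed_path set set" where
  "loops = based_loops // loop_rel"


section \<open>The metric on loops\<close>

definition time_changes :: "(real \<Rightarrow> real) set" where
  "time_changes = {\<phi>. bij_betw \<phi> {0..1} {0..1} \<and> strict_mono_on {0..1} \<phi>}"

text \<open>
  Both suprema may be infinite for a particular \<open>\<phi>\<close>, hence \<open>ereal\<close>. The infimum is finite: paths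
  in \<open>path_space 1\<close> are bounded, so the identity has finite cost.
\<close>

definition skorokhod_dist :: "(real \<Rightarrow> 'a::metric_space) \<Rightarrow> (real \<Rightarrow> 'a) \<Rightarrow> real" where
  "skorokhod_dist l1 l2 = real_of_ereal (INF \<phi>\<in>time_changes.
     (SUP (s, t)\<in>{(s, t). 0 \<le> s \<and> s < t \<and> t \<le> 1}. ereal \<bar>ln ((\<phi> t - \<phi> s) / (t - s))\<bar>) +
     (SUP u\<in>{0..1}. ereal (dist (l1 (\<phi> u)) (l2 u))))"

definition normalized :: "'a timed_path \<Rightarrow> real \<Rightarrow> 'a" where
  "normalized l = (\<lambda>u\<in>{0..1}. snd l (fst l * u))"

definition based_loop_dist :: "'a::metric_space timed_path \<Rightarrow> 'a timed_path \<Rightarrow> real" where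
  "based_loop_dist l1 l2 =
     \<bar>fst l1 - fst l2\<bar> + skorokhod_dist (normalized l1) (normalized l2)"

definition loop_dist :: "'a::metric_space timed_path set \<Rightarrow> 'a timed_path set \<Rightarrow> real" where
  "loop_dist L1 L2 = (INF (l, l')\<in>L1 \<times> L2. based_loop_dist l l')"

definition loop_topology :: "'a::metric_space timed_path set topology" where
  "loop_topology = dist_topology loops loop_dist"


section \<open>The multi-occupation field\<close>

text \<open>
  Points of \<open>S\<^sup>n\<close> are extensional functions on \<open>{..<n}\<close>: the coordinate \<open>z\<^sup>i\<close> is \<open>z (i - 1)\<close>.
\<close>

definition power_topology :: "nat \<Rightarrow> (nat \<Rightarrow> 'a::topological_space) topology" where
  "power_topology n = product_topology (\<lambda>_. euclidean) {..<n}"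

definition rotate_tuple :: "nat \<Rightarrow> nat \<Rightarrow> (nat \<Rightarrow> 'a) \<Rightarrow> nat \<Rightarrow> 'a" where
  "rotate_tuple n j z = (\<lambda>i\<in>{..<n}. z ((i + j) mod n))"

definition ordered_times :: "nat \<Rightarrow> real \<Rightarrow> (nat \<Rightarrow> real) set" where
  "ordered_times n t = {s \<in> {..<n} \<rightarrow>\<^sub>E {0<..<t}. strict_mono_on {..<n} s}"

definition multi_occ :: "nat \<Rightarrow> 'a timed_path \<Rightarrow> ((nat \<Rightarrow> 'a) \<Rightarrow> real) \<Rightarrow> real" where
  "multi_occ n l f = (\<Sum>j<n.
     LINT s:ordered_times n (fst l)|(\<Pi>\<^sub>M i\<in>{..<n}. lborel).
       f (rotate_tuple n j (\<lambda>i\<in>{..<n}. snd l (s i))))"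

text \<open>The common value of \<open>multi_occ\<close> on the based loops of an equivalence class.\<close>

definition loop_multi_occ :: "nat \<Rightarrow> 'a timed_path set \<Rightarrow> ((nat \<Rightarrow> 'a) \<Rightarrow> real) \<Rightarrow> real" where
  "loop_multi_occ n L f = the_elem ((\<lambda>l. multi_occ n l f) ` L)"

end

theory Submission
  imports Defs
begin

text \<open>
  The sum over rotations of the ordered simplex is the integral over all cyclically ordered tuples.
  For each loop \<open>l\<close> the functional \<open>f \<mapsto> \<langle>l,f\<rangle>\<close> is therefore integration
  against one finite measure \<open>\<kappa> l\<close>, the image of Lebesgue measure on the cyclically ordered tuples, and
  it does not change when the loop is shifted. By a monotone class argument it suffices to treat indicators of
  open boxes, hence products of bounded continuous functions of one coordinate. For these,
  \<open>l \<mapsto> \<langle>l,f\<rangle>\<close> is continuous: if \<open>D\<^sup>o(l, l\<^sub>k) \<rightarrow> 0\<close>, then along a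
  subsequence representatives of \<open>l\<^sub>k\<close> converge, outside a countable set of times, to a shift of
  a representative of \<open>l\<close>, and dominated convergence applies. The limiting shift need not be a based loop,
  which is why shift invariance is proved for all measurable periodic functions.
\<close>

section \<open>Integrals against a kernel of finite measures\<close>

text \<open>Invariance and continuity call for different descriptions of the same integral. The
  ordered simplex is not stable under rotation of the circle: some coordinates are carried past the
  end of the time interval, and the order breaks at another index. The cyclically ordered tuples are
  stable, and a substitution then gives shift invariance. When the duration varies, the simplex is
  the better form, since \<open>t\<close> enters it only through the inequalities
  \<open>s i < t\<close>, which are eventually constant along converging durations unless some
  coordinate equals \<open>t\<close>.

  The loop metric only provides near-optimal representatives, and those of the limit loop vary along
  the sequence. All are shifts of one fixed \<open>(t, p)\<close> by some \<open>a\<close> in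
  \<open>{0..<t}\<close>; these accumulate in the compact interval \<open>{0..t}\<close>, where the
  limit can be \<open>t\<close> or a jump time of \<open>p\<close>. A time change whose slopes have
  small logarithms is uniformly close to the identity, which reduces Skorokhod closeness to
  pointwise convergence at the continuity times of the shifted path.\<close>

lemma borel_measurable_integral_kernel:
  fixes K :: "'b \<Rightarrow> 'a measure" and f :: "'a \<Rightarrow> real"
  assumes G: "Int_stable G" "G \<subseteq> Pow \<Omega>" "\<Omega> \<in> G"
    and fin: "\<And>x. x \<in> space R \<Longrightarrow> finite_measure (K x)"
    and K: "\<And>x. x \<in> space R \<Longrightarrow> sets (K x) = sigma_sets \<Omega> G"
    and m: "\<And>A. A \<in> G \<Longrightarrow> (\<lambda>x. measure (K x) A) \<in> borel_measurable R"
    and f: "f \<in> borel_measurable (sigma \<Omega> G)" "\<And>z. z \<in> \<Omega> \<Longrightarrow> \<bar>f z\<bar> \<le> B"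
  shows "(\<lambda>x. \<integral>z. f z \<partial>K x) \<in> borel_measurable R"
proof -
  let ?N = "sigma \<Omega> G"
  have N: "sets ?N = sigma_sets \<Omega> G" "space ?N = \<Omega>"
    using G by (auto simp: sets_measure_of space_measure_of)
  have sp: "space (K x) = \<Omega>" if "x \<in> space R" for x
    using sets_eq_imp_space_eq[of "K x" ?N] K[OF that] N by simp
  \<comment> \<open>Dynkin's argument: \<open>G\<close> is closed under intersections, and
    finiteness of \<open>K x\<close> turns a complement into a difference of measurable functions
    and a disjoint union into a convergent series.\<close>
  have sm: "(\<lambda>x. measure (K x) A) \<in> borel_measurable R" if "A \<in> sigma_sets \<Omega> G" for A
    using G(1,2) that
  proof (induction rule: sigma_sets_induct_disjoint)
    case (compl A)
    have "measure (K x) (\<Omega> - A) = measure (K x) \<Omega> - measure (K x) A" if "x \<in> space R" for x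
      using finite_measure.finite_measure_compl[OF fin[OF that], of A] K[OF that] sp[OF that] compl by simp
    moreover have "(\<lambda>x. measure (K x) \<Omega> - measure (K x) A) \<in> borel_measurable R"
      using m[OF G(3)] compl by simp
    ultimately show ?case by (simp cong: measurable_cong)
  next
    case (union A)
    have "(\<lambda>i. measure (K x) (A i)) sums measure (K x) (\<Union>i. A i)" if "x \<in> space R" for x
      using K[OF that] union finite_measure.finite_measure_UNION[OF fin[OF that], of A] by auto
    then have "measure (K x) (\<Union>i. A i) = (\<Sum>i. measure (K x) (A i))" if "x \<in> space R" for x
      using that by (simp add: sums_iff)
    moreover have "(\<lambda>x. \<Sum>i. measure (K x) (A i)) \<in> borel_measurable R"
      using union by (intro borel_measurable_suminf) auto
    ultimately show ?case by (simp cong: measurable_cong)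
  qed (use m in auto)
  \<comment> \<open>Base point 0 makes the simple approximations dominated by twice
    \<open>\<bar>f z\<bar>\<close>; hence the constant \<open>2 * B\<close> below.\<close>
  obtain F where F: "\<And>i. simple_function ?N (F i)" "\<And>z. z \<in> \<Omega> \<Longrightarrow> (\<lambda>i. F i z) \<longlonglongrightarrow> f z"
    "\<And>i z. z \<in> \<Omega> \<Longrightarrow> dist (F i z) 0 \<le> 2 * dist (f z) 0"
    using borel_measurable_implies_sequence_metric[OF f(1), of 0] unfolding N by metis
  have lim: "(\<lambda>i. \<integral>z. F i z \<partial>K x) \<longlonglongrightarrow> (\<integral>z. f z \<partial>K x)" if x: "x \<in> space R" for x
  proof (rule integral_dominated_convergence[where w = "\<lambda>_. 2 * B"])
    interpret finite_measure "K x" using fin[OF x] .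
    have e: "borel_measurable (K x) = (borel_measurable ?N :: ('a \<Rightarrow> real) set)"
      by (rule measurable_cong_sets) (simp_all add: K[OF x] N)
    show "f \<in> borel_measurable (K x)" "\<And>i. F i \<in> borel_measurable (K x)"
      unfolding e using f(1) F(1) by (blast intro: borel_measurable_simple_function)+
    show "integrable (K x) (\<lambda>_. 2 * B)" by simp
    show "AE z in K x. (\<lambda>i. F i z) \<longlonglongrightarrow> f z" using F by (intro AE_I2) (simp add: sp[OF x])
    show "AE z in K x. norm (F i z) \<le> 2 * B" for i
    proof (rule AE_I2)
      fix z assume "z \<in> space (K x)"
      then show "norm (F i z) \<le> 2 * B" using F(3)[of z i] f(2)[of z] by (simp add: sp[OF x])
    qed
  qed
  show ?thesis
  proof (rule borel_measurable_LIMSEQ_real[OF lim])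
    fix i
    have fin': "finite (F i ` \<Omega>)" and F': "\<And>y. F i -` {y} \<inter> \<Omega> \<in> sigma_sets \<Omega> G"
      using F(1)[of i] simple_functionD[OF F(1)[of i]] N by auto
    have "(\<integral>z. F i z \<partial>K x) = (\<Sum>y\<in>F i ` \<Omega>. y * measure (K x) (F i -` {y} \<inter> \<Omega>))" if x: "x \<in> space R" for x
    proof -
      interpret finite_measure "K x" using fin[OF x] .
      have eq: "F i z = (\<Sum>y\<in>F i ` \<Omega>. y * indicator (F i -` {y} \<inter> \<Omega>) z)" if z: "z \<in> \<Omega>" for z
      proof -
        have "(\<Sum>y\<in>F i ` \<Omega>. y * indicator (F i -` {y} \<inter> \<Omega>) z) = (\<Sum>y\<in>F i ` \<Omega>. if y = F i z then y else 0)"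
          by (rule sum.cong) (use z in \<open>auto simp: indicator_def\<close>)
        then show ?thesis using fin' z by simp
      qed
      have "(\<integral>z. F i z \<partial>K x) = (\<integral>z. (\<Sum>y\<in>F i ` \<Omega>. y * indicator (F i -` {y} \<inter> \<Omega>) z) \<partial>K x)"
        by (rule Bochner_Integration.integral_cong[OF refl], rule eq) (simp only: sp[OF x])
      also have "\<dots> = (\<Sum>y\<in>F i ` \<Omega>. y * measure (K x) (F i -` {y} \<inter> \<Omega>))"
      proof (subst Bochner_Integration.integral_sum)
        fix y
        have "F i -` {y} \<inter> \<Omega> \<in> sets (K x)" using F' K[OF x] by simp
        then show "integrable (K x) (\<lambda>z. y * indicator (F i -` {y} \<inter> \<Omega>) z)"
          by (intro integrable_mult_right integrable_real_indicator) (simp_all add: less_top[symmetric])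
      next
        have "space (K x) \<inter> (F i -` {y} \<inter> \<Omega>) = F i -` {y} \<inter> \<Omega>" for y using sp[OF x] by blast
        then show "(\<Sum>y\<in>F i ` \<Omega>. \<integral>z. y * indicator (F i -` {y} \<inter> \<Omega>) z \<partial>K x) =
            (\<Sum>y\<in>F i ` \<Omega>. y * measure (K x) (F i -` {y} \<inter> \<Omega>))"
          by (simp add: Int_commute Int_left_commute)
      qed
      finally show ?thesis .
    qed
    moreover have "(\<lambda>x. \<Sum>y\<in>F i ` \<Omega>. y * measure (K x) (F i -` {y} \<inter> \<Omega>)) \<in> borel_measurable R"
      using sm F' by (intro borel_measurable_sum borel_measurable_times) auto
    ultimately show "(\<lambda>x. \<integral>z. F i z \<partial>K x) \<in> borel_measurable R"
      by (simp cong: measurable_cong)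
  qed
qed

section \<open>Open boxes as generators of the Borel \<sigma>-field of a finite power\<close>

definition open_boxes :: "nat \<Rightarrow> (nat \<Rightarrow> 'a::topological_space) set set" where
  "open_boxes n = {PiE {..<n} U |U. \<forall>i. open (U i)}"

lemma topspace_power_topology: "topspace (power_topology n) = PiE {..<n} (\<lambda>_. UNIV)"
  by (simp add: power_topology_def)

lemma Int_stable_open_boxes: "Int_stable (open_boxes n)"
proof (rule Int_stableI)
  fix A B :: "(nat \<Rightarrow> 'a) set" assume "A \<in> open_boxes n" "B \<in> open_boxes n"
  then obtain U V where "A = PiE {..<n} U" "B = PiE {..<n} V" "\<forall>i. open (U i)" "\<forall>i. open (V i)"
    by (auto simp: open_boxes_def)
  then show "A \<inter> B \<in> open_boxes n"
    by (auto simp: open_boxes_def PiE_Int intro!: exI[of _ "\<lambda>i. U i \<inter> V i"])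
qed

lemma open_boxes_openin: "A \<in> open_boxes n \<Longrightarrow> openin (power_topology n) A"
  by (auto simp: open_boxes_def power_topology_def openin_PiE)

lemma open_boxes_Pow: "open_boxes n \<subseteq> Pow (PiE {..<n} (\<lambda>_. UNIV))"
  by (auto simp: open_boxes_def PiE_def)

text \<open>A box with sides in a countable basis is given by finitely many basis sets, so there are
  only countably many such boxes. Countability is what puts every open set into the \<sigma>-algebra
  generated by the boxes.\<close>

lemma openin_power_topology_Union_boxes:
  fixes A :: "(nat \<Rightarrow> 'a::second_countable_topology) set"
  assumes "openin (power_topology n) A"
  obtains \<B> where "countable \<B>" "\<B> \<subseteq> open_boxes n" "A = \<Union>\<B>"
proof -
  obtain B :: "'a set set" where B: "countable B" "topological_basis B"
    using ex_countable_basis by blast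
  define \<B> where "\<B> = {W \<in> PiE {..<n} ` (PiE {..<n} (\<lambda>_. B)). W \<subseteq> A}"
  have "countable (PiE {..<n} (\<lambda>_. B))" using B by (intro countable_PiE) auto
  then have 1: "countable \<B>" unfolding \<B>_def by (auto intro: countable_subset[OF _ countable_image])
  have 2: "\<B> \<subseteq> open_boxes n"
  proof
    fix W assume "W \<in> \<B>"
    then obtain U where U: "U \<in> PiE {..<n} (\<lambda>_. B)" "W = PiE {..<n} U" by (auto simp: \<B>_def)
    then have "open (U i)" if "i < n" for i
      using that B(2) topological_basis_open by (auto simp: PiE_iff)
    \<comment> \<open>\<open>open_boxes\<close> asks for an open side at every index, whereas
      \<open>U\<close> is controlled only below \<open>n\<close>; the empty set fills the rest
      without changing the product.\<close>
    then show "W \<in> open_boxes n" unfolding open_boxes_def using U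
      by (auto intro!: exI[of _ "\<lambda>i. if i < n then U i else {}"] PiE_cong)
  qed
  have "z \<in> \<Union>\<B>" if zA: "z \<in> A" for z
  proof -
    obtain V where V: "\<And>i. i < n \<Longrightarrow> open (V i)" "z \<in> PiE {..<n} V" "PiE {..<n} V \<subseteq> A"
      using assms[unfolded power_topology_def openin_product_topology_alt, rule_format, OF zA]
      by (metis lessThan_iff open_openin)
    have "\<exists>W\<in>B. z i \<in> W \<and> W \<subseteq> V i" if "i < n" for i
    proof -
      have "z i \<in> V i" using V(2) that by (simp add: PiE_iff)
      then show ?thesis using topological_basisE[OF B(2) V(1)[OF that]] by metis
    qed
    then obtain W where W: "\<And>i. i < n \<Longrightarrow> W i \<in> B \<and> z i \<in> W i \<and> W i \<subseteq> V i" by (metis lessThan_iff)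
    have "PiE {..<n} (restrict W {..<n}) \<subseteq> PiE {..<n} V"
      using W by (intro PiE_mono) auto
    then have "PiE {..<n} (restrict W {..<n}) \<in> \<B>"
      using W V(3) unfolding \<B>_def by auto
    moreover have "z \<in> PiE {..<n} (restrict W {..<n})" using W V(2) by (auto simp: PiE_iff)
    ultimately show ?thesis by blast
  qed
  then have "A = \<Union>\<B>" unfolding \<B>_def by blast
  then show ?thesis using that 1 2 by blast
qed

lemma sets_borel_of: "sets (borel_of T) = sigma_sets (topspace T) {U. openin T U}"
  unfolding borel_of_def by (rule sets_measure_of) (auto dest: openin_subset)

lemma space_borel_of: "space (borel_of T) = topspace T"
  unfolding borel_of_def by (rule space_measure_of) (auto dest: openin_subset)

lemma sets_borel_of_power_topology:
  "sets (borel_of (power_topology n :: (nat \<Rightarrow> 'a::second_countable_topology) topology)) =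
    sigma_sets (PiE {..<n} (\<lambda>_. UNIV)) (open_boxes n)"
  unfolding sets_borel_of topspace_power_topology
proof (rule sigma_sets_eqI)
  fix A :: "(nat \<Rightarrow> 'a) set" assume "A \<in> {U. openin (power_topology n) U}"
  then obtain \<B> where "countable \<B>" "\<B> \<subseteq> open_boxes n" "A = \<Union>\<B>"
    using openin_power_topology_Union_boxes by blast
  then show "A \<in> sigma_sets (PiE {..<n} (\<lambda>_. UNIV)) (open_boxes n)"
    using sigma_sets_UNION[of \<B>] sigma_sets.Basic by (metis subsetD)
qed (use open_boxes_openin in blast)

lemma borel_measurable_borel_of_eq:
  "borel_measurable (borel_of (power_topology n)) =
    (borel_measurable (sigma (PiE {..<n} (\<lambda>_. UNIV)) (open_boxes n))
      :: ((nat \<Rightarrow> 'a::second_countable_topology) \<Rightarrow> 'b::topological_space) set)"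
  by (rule measurable_cong_sets) (simp_all add: sets_borel_of_power_topology sets_measure_of open_boxes_Pow)

lemma measurable_into_power:
  fixes Z :: "'b \<Rightarrow> nat \<Rightarrow> 'a::second_countable_topology"
  assumes "\<And>i. i < n \<Longrightarrow> (\<lambda>x. Z x i) \<in> borel_measurable M"
  shows "(\<lambda>x. \<lambda>i\<in>{..<n}. Z x i) \<in> measurable M (borel_of (power_topology n))"
proof (rule measurable_sigma_sets[OF sets_borel_of_power_topology open_boxes_Pow])
  fix A :: "(nat \<Rightarrow> 'a) set" assume "A \<in> open_boxes n"
  then obtain U where U: "A = PiE {..<n} U" "\<And>i. open (U i)" by (auto simp: open_boxes_def)
  have "{x \<in> space M. \<forall>i\<in>{..<n}. Z x i \<in> U i} \<in> sets M"
    using measurable_sets[OF assms borel_open[OF U(2)]]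
    by (intro sets.sets_Collect_finite_All) (auto simp: vimage_def Int_def conj_commute)
  also have "{x \<in> space M. \<forall>i\<in>{..<n}. Z x i \<in> U i} = (\<lambda>x. \<lambda>i\<in>{..<n}. Z x i) -` A \<inter> space M"
    by (rule set_eqI) (simp add: U(1) PiE_iff conj_commute)
  finally show "(\<lambda>x. \<lambda>i\<in>{..<n}. Z x i) -` A \<inter> space M \<in> sets M" .
qed simp

lemma measurable_power_component:
  fixes g :: "'a::second_countable_topology \<Rightarrow> 'b::topological_space"
  assumes "i < n" "g \<in> borel_measurable borel"
  shows "(\<lambda>z. g (z i)) \<in> borel_measurable (borel_of (power_topology n))"
proof -
  have "(\<lambda>z. z i :: 'a) \<in> borel_measurable (borel_of (power_topology n))"
  proof (rule borel_measurableI)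
    fix S :: "'a set" assume S: "open S"
    have "(\<lambda>z. z i) -` S \<inter> space (borel_of (power_topology n)) = PiE {..<n} (\<lambda>j. if j = i then S else UNIV)"
    proof (rule set_eqI)
      fix z
      have "(\<forall>j\<in>{..<n}. z j \<in> (if j = i then S else UNIV)) \<longleftrightarrow> z i \<in> S"
        using assms(1) by (metis UNIV_I lessThan_iff)
      then show "z \<in> (\<lambda>z. z i) -` S \<inter> space (borel_of (power_topology n)) \<longleftrightarrow>
          z \<in> PiE {..<n} (\<lambda>j. if j = i then S else UNIV)"
        by (simp only: vimage_eq Int_iff space_borel_of topspace_power_topology PiE_iff UNIV_I) simp
    qed
    also have "\<dots> \<in> open_boxes n"
      unfolding open_boxes_def mem_Collect_eq
      by (rule exI[of _ "\<lambda>j. if j = i then S else UNIV"]) (simp add: S)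
    finally show "(\<lambda>z. z i) -` S \<inter> space (borel_of (power_topology n)) \<in> sets (borel_of (power_topology n))"
      by (simp add: sets_borel_of_power_topology)
  qed
  then show ?thesis using assms(2) by (rule measurable_compose)
qed

text \<open>The approximants are truncated multiples of the distance to the complement, which is
  positive exactly on \<open>U\<close> because \<open>- U\<close> is closed.\<close>

lemma open_indicator_limit:
  fixes U :: "'a::metric_space set"
  assumes "open U"
  obtains h :: "nat \<Rightarrow> 'a \<Rightarrow> real" where "\<And>k. continuous_on UNIV (h k)" "\<And>k x. 0 \<le> h k x" "\<And>k x. h k x \<le> 1"
    "\<And>x. (\<lambda>k. h k x) \<longlonglongrightarrow> indicator U x"
proof (cases "U = UNIV")
  \<comment> \<open>\<open>infdist\<close> to the empty set is 0, so the general formula would give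
    the zero function here.\<close>
  case True
  then show ?thesis using that[of "\<lambda>_ _. 1"] by simp
next
  case False
  define h where "h k x = min 1 (real k * infdist x (- U))" for k x
  have "(\<lambda>k. h k x) \<longlonglongrightarrow> indicator U x" for x
  proof (cases "x \<in> U")
    case True
    then have "infdist x (- U) > 0" using assms False infdist_pos_not_in_closed[of "- U" x] by auto
    moreover have "eventually (\<lambda>k. 1 / infdist x (- U) \<le> real k) sequentially"
      using filterlim_real_sequentially by (simp add: filterlim_at_top)
    ultimately have "eventually (\<lambda>k. h k x = 1) sequentially"
      unfolding h_def by (auto elim!: eventually_mono simp: field_simps)
    then show ?thesis using True by (simp add: tendsto_eventually)
  qed (auto simp: h_def)
  then show ?thesis
    by (intro that[of h]) (auto simp: h_def infdist_nonneg intro!: continuous_intros)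
qed

section \<open>Periodic extensions of based loops\<close>

text \<open>Circular shifts become translations of the line, and the endpoint of the loop becomes an
  interior time. For \<open>t > 0\<close> only the values of \<open>p\<close> on
  \<open>{0..<t}\<close> enter.\<close>

definition periodic_ext :: "real \<Rightarrow> (real \<Rightarrow> 'a) \<Rightarrow> real \<Rightarrow> 'a" where
  "periodic_ext t p x = p (x - t * of_int \<lfloor>x / t\<rfloor>)"

lemma floor_div_unique:
  fixes t x :: real
  assumes "t > 0" "t * of_int k \<le> x" "x < t * of_int k + t"
  shows "\<lfloor>x / t\<rfloor> = k"
  using assms by (intro floor_unique) (auto simp: field_simps)

lemma periodic_ext_eq: "0 \<le> u \<Longrightarrow> u < t \<Longrightarrow> periodic_ext t p u = p u"
  using floor_div_unique[of t 0 u] by (simp add: periodic_ext_def)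

lemma periodic_ext_period:
  assumes "t > 0"
  shows "periodic_ext t p (x + t) = periodic_ext t p x"
proof -
  have "(x + t) / t = x / t + 1" using assms by (simp add: field_simps)
  then show ?thesis by (simp add: periodic_ext_def algebra_simps)
qed

lemma snd_circ_shift:
  assumes "t > 0" "p 0 = p t" "r \<in> {0..<t}" "u \<in> {0..t}"
  shows "snd (circ_shift r (t, p)) u = periodic_ext t p (u + r)"
proof (cases "u + r < t")
  case True
  then show ?thesis using assms by (simp add: circ_shift_def periodic_ext_eq)
next
  case False
  then have "periodic_ext t p (u + r) = p (u + r - t)"
    using periodic_ext_period[OF assms(1), of p "u + r - t"] assms by (simp add: periodic_ext_eq)
  \<comment> \<open>The first branch of \<open>circ_shift\<close> reaches this case only at
    \<open>u + r = t\<close>, where it reads \<open>p t\<close> while the extension reads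
    \<open>p 0\<close>.\<close>
  moreover have "p (u + r) = p (u + r - t)" if "u \<le> t - r"
  proof -
    have "u + r = t" using that False by simp
    then show ?thesis using assms(2) by simp
  qed
  ultimately show ?thesis using assms by (simp add: circ_shift_def)
qed

text \<open>Arbitrarily close to a point of \<open>D e\<close> there are values at mutual distance
  at least \<open>e\<close>. The one-sided limits at \<open>x\<close> rule this out at every other
  point near \<open>x\<close>, so \<open>D e\<close> does not accumulate and is countable. The sets
  for \<open>e = 1 / (m + 1)\<close> exhaust the discontinuities.\<close>

lemma countable_discontinuities:
  fixes Q :: "real \<Rightarrow> 'a::metric_space"
  assumes "\<And>x. \<exists>y. (Q \<longlongrightarrow> y) (at_left x)" "\<And>x. \<exists>y. (Q \<longlongrightarrow> y) (at_right x)"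
  shows "countable {x. \<not> isCont Q x}"
proof -
  define D where "D e = {x. \<forall>d>0. \<exists>y z. \<bar>y - x\<bar> < d \<and> \<bar>z - x\<bar> < d \<and> e \<le> dist (Q y) (Q z)}" for e :: real
  \<comment> \<open>Stated for an open interval so that it applies on each side of \<open>x\<close>
    separately, with the left or the right limit as \<open>c\<close>.\<close>
  have away: "w \<notin> D e" if w: "a < w" "w < b" and close: "\<And>u. a < u \<Longrightarrow> u < b \<Longrightarrow> dist (Q u) c < e / 2" for w a b c e
  proof -
    have "dist (Q y) (Q z) < e" if "\<bar>y - w\<bar> < min (w - a) (b - w)" "\<bar>z - w\<bar> < min (w - a) (b - w)" for y z
    proof (rule dist_triangle_half_r[of c])
      show "dist c (Q y) < e / 2" "dist c (Q z) < e / 2"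
        using close[of y] close[of z] that by (auto simp: dist_commute)
    qed
    moreover have "min (w - a) (b - w) > 0" using w by simp
    ultimately have "\<exists>d>0. \<forall>y z. \<bar>y - w\<bar> < d \<and> \<bar>z - w\<bar> < d \<longrightarrow> \<not> e \<le> dist (Q y) (Q z)"
      unfolding not_le by blast
    then show ?thesis unfolding D_def by blast
  qed
  have "\<forall>\<^sub>F w in at x. w \<notin> D e" if e: "e > 0" for x e
    unfolding eventually_at_split
  proof
    obtain c where "(Q \<longlongrightarrow> c) (at_left x)" using assms(1) by blast
    then have "\<forall>\<^sub>F u in at_left x. dist (Q u) c < e / 2" using e by (intro tendstoD) auto
    then obtain a where a: "a < x" "\<And>u. a < u \<Longrightarrow> u < x \<Longrightarrow> dist (Q u) c < e / 2"
      unfolding eventually_at_left_field by blast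
    then show "\<forall>\<^sub>F w in at_left x. w \<notin> D e" unfolding eventually_at_left_field
      by (intro exI[of _ a] conjI allI impI away[of a _ x c])
  next
    obtain c where "(Q \<longlongrightarrow> c) (at_right x)" using assms(2) by blast
    then have "\<forall>\<^sub>F u in at_right x. dist (Q u) c < e / 2" using e by (intro tendstoD) auto
    then obtain b where b: "x < b" "\<And>u. x < u \<Longrightarrow> u < b \<Longrightarrow> dist (Q u) c < e / 2"
      unfolding eventually_at_right_field by blast
    then show "\<forall>\<^sub>F w in at_right x. w \<notin> D e" unfolding eventually_at_right_field
      by (intro exI[of _ b] conjI allI impI away[of x _ b c])
  qed
  then have "countable (D e)" if "e > 0" for e
    using sparse_imp_countable[OF open_UNIV, of "D e"] that by (simp add: sparse_in_eventually_iff)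
  then have "countable (\<Union>m. D (inverse (real (Suc m))))" by (intro countable_UN) auto
  moreover have "{x. \<not> isCont Q x} \<subseteq> (\<Union>m. D (inverse (real (Suc m))))"
  proof (rule subsetI, rule ccontr)
    fix x assume x: "x \<in> {x. \<not> isCont Q x}" and nD: "x \<notin> (\<Union>m. D (inverse (real (Suc m))))"
    have "\<exists>d>0. \<forall>y. dist y x < d \<longrightarrow> dist (Q y) (Q x) < e" if e: "e > 0" for e
    proof -
      obtain m where m: "inverse (real (Suc m)) < e" using reals_Archimedean[OF e] by auto
      obtain d where d: "d > 0" "\<And>y z. \<bar>y - x\<bar> < d \<Longrightarrow> \<bar>z - x\<bar> < d \<Longrightarrow> dist (Q y) (Q z) < inverse (real (Suc m))"
      proof -
        have "x \<notin> D (inverse (real (Suc m)))" using nD by blast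
        then obtain d where "d > 0" "\<not> (\<exists>y z. \<bar>y - x\<bar> < d \<and> \<bar>z - x\<bar> < d \<and> inverse (real (Suc m)) \<le> dist (Q y) (Q z))"
          unfolding D_def by blast
        then show ?thesis using that[of d] not_le by blast
      qed
      then have "dist (Q y) (Q x) < e" if "dist y x < d" for y
      proof -
        have "dist (Q y) (Q x) < inverse (real (Suc m))"
          by (rule d(2)) (use that d(1) in \<open>simp_all add: dist_real_def\<close>)
        then show ?thesis using m by simp
      qed
      then show ?thesis using d(1) by blast
    qed
    then have "isCont Q x" by (simp add: continuous_at_eps_delta)
    then show False using x by simp
  qed
  ultimately show ?thesis by (rule countable_subset[rotated])
qed

text \<open>Finitely many neighbourhoods cover \<open>C\<close>; on each, the values lie in the unit
  balls around the two one-sided limits, except perhaps at the centre, whose value is added by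
  hand.\<close>

lemma bounded_image_of_one_sided_limits:
  fixes Q :: "real \<Rightarrow> 'a::metric_space"
  assumes "\<And>x. \<exists>y. (Q \<longlongrightarrow> y) (at_left x)" "\<And>x. \<exists>y. (Q \<longlongrightarrow> y) (at_right x)" "compact C"
  shows "bounded (Q ` C)"
proof -
  have "\<exists>S. open S \<and> x \<in> S \<and> bounded (Q ` S)" for x
  proof -
    obtain c c' where "(Q \<longlongrightarrow> c) (at_left x)" "(Q \<longlongrightarrow> c') (at_right x)" using assms by metis
    then have "\<forall>\<^sub>F u in at_left x. dist (Q u) c < 1" "\<forall>\<^sub>F u in at_right x. dist (Q u) c' < 1"
      by (auto intro: tendstoD)
    then have "\<forall>\<^sub>F u in at x. Q u \<in> cball c 1 \<union> cball c' 1"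
      unfolding eventually_at_split by (auto elim!: eventually_mono simp: dist_commute)
    then obtain S where S: "open S" "x \<in> S" "\<And>u. u \<in> S \<Longrightarrow> u \<noteq> x \<Longrightarrow> Q u \<in> cball c 1 \<union> cball c' 1"
      unfolding eventually_at_topological by blast
    then have "Q ` S \<subseteq> insert (Q x) (cball c 1 \<union> cball c' 1)" by blast
    then have "bounded (Q ` S)" by (rule bounded_subset[rotated]) (simp add: bounded_cball)
    then show ?thesis using S by blast
  qed
  then obtain S where S: "\<And>x. open (S x)" "\<And>x. x \<in> S x" "\<And>x. bounded (Q ` S x)" by metis
  have "C \<subseteq> (\<Union>x\<in>C. S x)" using S(2) by blast
  from compactE_image[OF assms(3) S(1) this] obtain X where X: "finite X" "C \<subseteq> (\<Union>x\<in>X. S x)" .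
  have "bounded (\<Union>x\<in>X. Q ` S x)" by (rule bounded_UN[OF X(1)]) (rule ballI, rule S(3))
  moreover have "Q ` C \<subseteq> (\<Union>x\<in>X. Q ` S x)" using image_mono[OF X(2), of Q] unfolding image_UN .
  ultimately show ?thesis by (rule bounded_subset)
qed

text \<open>On one side of \<open>x\<close> a periodic extension is \<open>p\<close> translated by a
  whole number of periods; this carries one-sided limits of \<open>p\<close> over to it.\<close>

lemma tendsto_shifted_path:
  fixes p Q :: "real \<Rightarrow> 'a::topological_space" and c x :: real
  assumes "\<forall>\<^sub>F y in at x within A. Q y = p (y - c)" "(p \<longlongrightarrow> q) (at (x - c) within B)"
    and "\<forall>\<^sub>F y in at x within A. y - c \<in> B \<and> y \<noteq> x"
  shows "(Q \<longlongrightarrow> q) (at x within A)"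
proof -
  have "filterlim (\<lambda>y. y - c) (at (x - c) within B) (at x within A)"
    unfolding filterlim_at using assms(3) by (auto elim!: eventually_mono intro!: tendsto_intros)
  then have "((\<lambda>y. p (y - c)) \<longlongrightarrow> q) (at x within A)" by (rule filterlim_compose[OF assms(2)])
  then show ?thesis using tendsto_cong[OF assms(1)] by blast
qed

section \<open>Regularity of the periodic extension of a based loop\<close>

context
  fixes t :: real and p :: "real \<Rightarrow> 'a::metric_space"
  assumes loop: "(t, p) \<in> based_loops"
begin

lemma based_loop_duration_pos: "t > 0" and based_loop_endpoints: "p 0 = p t" and based_loop_path: "p \<in> path_space t"
  using loop by (auto simp: based_loops_def)

lemma periodic_ext_at_right: "\<exists>y. (periodic_ext t p \<longlongrightarrow> y) (at_right x)"
proof -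
  define k where "k = \<lfloor>x / t\<rfloor>"
  have k: "t * of_int k \<le> x" "x < t * of_int k + t"
    using floor_divide_lower[OF based_loop_duration_pos, of x] floor_divide_upper[OF based_loop_duration_pos, of x]
    by (simp_all add: k_def algebra_simps)
  have "(p \<longlongrightarrow> p (x - t * of_int k)) (at_right (x - t * of_int k))"
    using based_loop_path k by (auto simp: path_space_def)
  moreover have "\<forall>\<^sub>F y in at_right x. periodic_ext t p y = p (y - t * of_int k)"
    unfolding eventually_at_right_field
    using k floor_div_unique[OF based_loop_duration_pos, of k]
    by (intro exI[of _ "t * of_int k + t"]) (auto simp: periodic_ext_def)
  moreover have "\<forall>\<^sub>F y in at_right x. y - t * of_int k \<in> {x - t * of_int k<..} \<and> y \<noteq> x"
    unfolding eventually_at_right_field by (intro exI[of _ "x + 1"]) auto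
  ultimately show ?thesis using tendsto_shifted_path by blast
qed

lemma periodic_ext_at_left: "\<exists>y. (periodic_ext t p \<longlongrightarrow> y) (at_left x)"
proof -
  \<comment> \<open>Here \<open>x\<close> must lie in the period closed on the right, unlike for
    right limits, where the floor is used: at a multiple of \<open>t\<close> the left limit is read
    off at the end of the preceding period.\<close>
  define k where "k = \<lceil>x / t\<rceil> - 1"
  have k: "t * of_int k < x" "x \<le> t * of_int k + t"
    using ceiling_divide_lower[OF based_loop_duration_pos, of x] ceiling_divide_upper[OF based_loop_duration_pos, of x]
    by (simp_all add: k_def algebra_simps)
  obtain y where "(p \<longlongrightarrow> y) (at_left (x - t * of_int k))"
  proof -
    have "x - t * of_int k \<in> {0<..t}" using k by simp
    then have "\<exists>y. (p \<longlongrightarrow> y) (at_left (x - t * of_int k))" using based_loop_path unfolding path_space_def by blast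
    then show ?thesis using that by blast
  qed
  moreover have "\<forall>\<^sub>F y in at_left x. periodic_ext t p y = p (y - t * of_int k)"
    unfolding eventually_at_left_field
    using k floor_div_unique[OF based_loop_duration_pos, of k]
    by (intro exI[of _ "t * of_int k"]) (auto simp: periodic_ext_def)
  moreover have "\<forall>\<^sub>F y in at_left x. y - t * of_int k \<in> {..<x - t * of_int k} \<and> y \<noteq> x"
    unfolding eventually_at_left_field by (intro exI[of _ "x - 1"]) auto
  ultimately show ?thesis using tendsto_shifted_path by blast
qed

lemma countable_discont_periodic_ext: "countable {x. \<not> isCont (periodic_ext t p) x}"
  by (intro countable_discontinuities periodic_ext_at_left periodic_ext_at_right)

lemma borel_measurable_periodic_ext: "periodic_ext t p \<in> borel_measurable borel"
  by (rule borel_measurable_continuous_countable_exceptions[OF countable_discont_periodic_ext])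
    (auto simp: continuous_on_eq_continuous_within intro: continuous_at_imp_continuous_at_within)

lemma bounded_normalized: "bounded (normalized (t, p) ` {0..1})"
proof -
  have "bounded (periodic_ext t p ` {0..t})"
    by (intro bounded_image_of_one_sided_limits periodic_ext_at_left periodic_ext_at_right) auto
  moreover have "normalized (t, p) ` {0..1} \<subseteq> insert (p t) (periodic_ext t p ` {0..t})"
  proof (rule image_subsetI)
    fix u :: real assume u: "u \<in> {0..1}"
    have tu: "0 \<le> t * u" "t * u \<le> t" using u based_loop_duration_pos by (auto simp: mult_left_le)
    show "normalized (t, p) u \<in> insert (p t) (periodic_ext t p ` {0..t})"
    proof (cases "t * u = t")
      case False
      then have "normalized (t, p) u = periodic_ext t p (t * u)"
        using u tu by (simp add: normalized_def periodic_ext_eq)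
      then show ?thesis using tu by (intro insertI2 image_eqI) auto
    qed (use u based_loop_duration_pos in \<open>auto simp: normalized_def\<close>)
  qed
  ultimately show ?thesis by (metis bounded_insert bounded_subset)
qed

end

section \<open>Time changes and the Skorokhod distance\<close>

lemma id_time_change: "id \<in> time_changes"
  by (auto simp: time_changes_def strict_mono_on_def)

lemma skorokhod_dist_nonneg: "0 \<le> skorokhod_dist l1 l2"
  unfolding skorokhod_dist_def
proof (intro real_of_ereal_pos INF_greatest add_nonneg_nonneg)
  fix \<phi> :: "real \<Rightarrow> real"
  show "0 \<le> (SUP (s, t)\<in>{(s, t). 0 \<le> s \<and> s < t \<and> t \<le> 1}. ereal \<bar>ln ((\<phi> t - \<phi> s) / (t - s))\<bar>)"
    by (rule SUP_upper2[of "(0, 1)"]) auto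
  show "0 \<le> (SUP u\<in>{0..1}. ereal (dist (l1 (\<phi> u)) (l2 u)))"
    by (rule SUP_upper2[of 0]) auto
qed

text \<open>\<open>real_of_ereal\<close> sends infinity to 0, so a small distance says something
  about the infimum only once the infimum is known to be finite. Boundedness of both images gives
  this: the identity costs at most a bound \<open>K\<close> on the mutual distances.\<close>

lemma skorokhod_dist_lessE:
  fixes l1 l2 :: "real \<Rightarrow> 'a::metric_space"
  assumes "bounded (l1 ` {0..1})" "bounded (l2 ` {0..1})" "skorokhod_dist l1 l2 < r"
  obtains \<phi> where "\<phi> \<in> time_changes"
    "\<And>s t. 0 \<le> s \<Longrightarrow> s < t \<Longrightarrow> t \<le> 1 \<Longrightarrow> \<bar>ln ((\<phi> t - \<phi> s) / (t - s))\<bar> < r"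
    "\<And>u. u \<in> {0..1} \<Longrightarrow> dist (l1 (\<phi> u)) (l2 u) < r"
proof -
  define A where "A \<phi> = (SUP (s, t)\<in>{(s, t). 0 \<le> s \<and> s < t \<and> t \<le> 1}. ereal \<bar>ln ((\<phi> t - \<phi> s) / (t - s))\<bar>)" for \<phi> :: "real \<Rightarrow> real"
  define B where "B \<phi> = (SUP u\<in>{0..1}. ereal (dist (l1 (\<phi> u)) (l2 u)))" for \<phi> :: "real \<Rightarrow> real"
  define I where "I = (INF \<phi>\<in>time_changes. A \<phi> + B \<phi>)"
  have I: "skorokhod_dist l1 l2 = real_of_ereal I"
    unfolding I_def A_def B_def skorokhod_dist_def ..
  have A0: "0 \<le> A \<phi>" for \<phi> unfolding A_def by (rule SUP_upper2[of "(0, 1)"]) auto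
  have B0: "0 \<le> B \<phi>" for \<phi> unfolding B_def by (rule SUP_upper2[of 0]) auto
  define S where "S = l1 ` {0..1} \<union> l2 ` {0..1}"
  have "bounded S" using assms(1,2) unfolding S_def by simp
  then obtain K where K: "\<And>x y. x \<in> S \<Longrightarrow> y \<in> S \<Longrightarrow> dist x y \<le> K"
    using bounded_two_points by metis
  have "A id \<le> 0" unfolding A_def by (rule SUP_least) auto
  moreover have "B id \<le> ereal K" unfolding B_def by (rule SUP_least) (simp add: K S_def)
  ultimately have "A id + B id \<le> 0 + ereal K" by (rule add_mono)
  then have "I \<le> ereal K" unfolding I_def by (intro INF_lower2[OF id_time_change]) simp
  moreover have "0 \<le> I" unfolding I_def by (intro INF_greatest add_nonneg_nonneg A0 B0)
  ultimately have "I = ereal (skorokhod_dist l1 l2)"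
    unfolding I by (cases I) auto
  then have "I < ereal r" using assms(3) by simp
  then obtain \<phi> where \<phi>: "\<phi> \<in> time_changes" "A \<phi> + B \<phi> < ereal r"
    unfolding I_def INF_less_iff by blast
  have "A \<phi> \<le> A \<phi> + B \<phi>" "B \<phi> \<le> A \<phi> + B \<phi>"
    using A0[of \<phi>] B0[of \<phi>] by (auto simp: ereal_le_add_self ereal_le_add_self2)
  then have "A \<phi> < ereal r" "B \<phi> < ereal r" using \<phi>(2) by (auto intro: le_less_trans)
  note 1 = SUP_lessD[OF this(1)[unfolded A_def]] and 2 = SUP_lessD[OF this(2)[unfolded B_def]]
  have "\<bar>ln ((\<phi> t - \<phi> s) / (t - s))\<bar> < r" if "0 \<le> s" "s < t" "t \<le> 1" for s t
    using 1[of "(s, t)"] that by simp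
  moreover have "dist (l1 (\<phi> u)) (l2 u) < r" if "u \<in> {0..1}" for u
    using 2[OF that] by simp
  ultimately show ?thesis using that \<phi>(1) by blast
qed

text \<open>An increasing bijection fixes 0, so the slope condition for the pair 0 and
  \<open>u\<close> traps \<open>\<phi> u\<close> between \<open>u * exp (- r)\<close> and
  \<open>u * exp r\<close>. The upper bound is the worse one, whence the constant.\<close>

lemma time_change_close_to_id:
  assumes \<phi>: "\<phi> \<in> time_changes"
    and r: "\<And>s t. 0 \<le> s \<Longrightarrow> s < t \<Longrightarrow> t \<le> 1 \<Longrightarrow> \<bar>ln ((\<phi> t - \<phi> s) / (t - s))\<bar> < r"
    and u: "u \<in> {0..1}"
  shows "\<phi> u \<in> {0..1}" "\<bar>\<phi> u - u\<bar> \<le> exp r - 1"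
proof -
  have b: "bij_betw \<phi> {0..1} {0..1}" and m: "strict_mono_on {0..1} \<phi>"
    using \<phi> by (auto simp: time_changes_def)
  have in01: "\<phi> v \<in> {0..1}" if "v \<in> {0..1}" for v using b that by (rule bij_betw_apply)
  then show "\<phi> u \<in> {0..1}" using u .
  obtain v where v: "v \<in> {0..1}" "\<phi> v = 0" using b by (metis atLeastAtMost_iff bij_betw_iff_bijections order_refl zero_le_one)
  have \<phi>0: "\<phi> 0 = 0"
  proof (cases "v = 0")
    case False
    then have "\<phi> 0 < \<phi> v" using v by (intro strict_mono_onD[OF m]) auto
    then show ?thesis using in01[of 0] v by simp
  qed (use v in simp)
  have "r > 0" using r[of 0 1] by linarith
  \<comment> \<open>Add \<open>1 + x \<le> exp x\<close> at \<open>x = r\<close> and at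
    \<open>x = - r\<close>.\<close>
  have e: "1 - exp (- r) \<le> exp r - 1"
    using exp_ge_add_one_self[of r] exp_ge_add_one_self[of "- r"] by linarith
  show "\<bar>\<phi> u - u\<bar> \<le> exp r - 1"
  proof (cases "u = 0")
    case False
    then have u0: "0 < u" "u \<le> 1" using u by auto
    have pos: "\<phi> u > 0" using strict_mono_onD[OF m, of 0 u] u0 \<phi>0 by simp
    have "\<bar>ln (\<phi> u / u)\<bar> < r" using r[of 0 u] u0 \<phi>0 by simp
    then have "exp (- r) < \<phi> u / u" "\<phi> u / u < exp r"
      using pos u0 exp_less_cancel_iff[of "ln (\<phi> u / u)" r] exp_less_cancel_iff[of "- r" "ln (\<phi> u / u)"]
      by (auto simp: abs_less_iff)
    then have h: "u * exp (- r) \<le> \<phi> u" "\<phi> u \<le> u * exp r" using u0 by (auto simp: field_simps)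
    have "u * (exp r - 1) \<le> exp r - 1" "u * (1 - exp (- r)) \<le> 1 - exp (- r)"
      using u0 \<open>r > 0\<close> by (auto intro!: mult_left_le_one_le)
    then show ?thesis using h e by (simp add: algebra_simps abs_le_iff)
  qed (use \<phi>0 \<open>r > 0\<close> in simp)
qed

section \<open>Measure-preserving maps of Lebesgue measure on tuples\<close>

abbreviation lborel_power :: "nat \<Rightarrow> (nat \<Rightarrow> real) measure" where
  "lborel_power n \<equiv> Pi\<^sub>M {..<n} (\<lambda>_. lborel)"

interpretation lborel_product: product_sigma_finite "\<lambda>_::nat. lborel :: real measure" ..

text \<open>Boxes determine the product measure, and the preimage of a box is the box whose sides
  are permuted by the inverse of \<open>\<sigma>\<close>.\<close>

lemma distr_lborel_power_reindex:
  assumes \<sigma>: "bij_betw \<sigma> {..<n} {..<n}"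
  shows "distr (lborel_power n) (lborel_power n) (\<lambda>s. \<lambda>i\<in>{..<n}. s (\<sigma> i)) = lborel_power n"
proof (rule lborel_product.PiM_eqI)
  fix A :: "nat \<Rightarrow> real set" assume A: "\<And>i. i \<in> {..<n} \<Longrightarrow> A i \<in> sets lborel"
  define \<tau> where "\<tau> = inv_into {..<n} \<sigma>"
  have \<tau>: "bij_betw \<tau> {..<n} {..<n}" unfolding \<tau>_def using \<sigma> by (rule bij_betw_inv_into)
  have \<tau>\<sigma>: "\<tau> (\<sigma> i) = i" "\<sigma> i < n" if "i < n" for i
    using that \<sigma> bij_betw_inv_into_left[OF \<sigma>, of i] bij_betw_apply[OF \<sigma>, of i] by (auto simp: \<tau>_def)
  have \<sigma>\<tau>: "\<sigma> (\<tau> i) = i" "\<tau> i < n" if "i < n" for i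
    using that bij_betw_inv_into_right[OF \<sigma>, of i] bij_betw_apply[OF \<tau>, of i] by (auto simp: \<tau>_def)
  have m: "(\<lambda>s. \<lambda>i\<in>{..<n}. s (\<sigma> i)) \<in> measurable (lborel_power n) (lborel_power n)"
    using \<tau>\<sigma> by (intro measurable_restrict measurable_component_singleton) auto
  have "(\<lambda>s. \<lambda>i\<in>{..<n}. s (\<sigma> i)) -` PiE {..<n} A \<inter> space (lborel_power n) = PiE {..<n} (\<lambda>i. A (\<tau> i))"
  proof (rule set_eqI)
    fix s :: "nat \<Rightarrow> real"
    have "(\<forall>i\<in>{..<n}. s (\<sigma> i) \<in> A i) \<longleftrightarrow> (\<forall>i\<in>{..<n}. s i \<in> A (\<tau> i))"
      using \<sigma>\<tau> \<tau>\<sigma> by (metis lessThan_iff)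
    then show "s \<in> (\<lambda>s. \<lambda>i\<in>{..<n}. s (\<sigma> i)) -` PiE {..<n} A \<inter> space (lborel_power n) \<longleftrightarrow>
        s \<in> PiE {..<n} (\<lambda>i. A (\<tau> i))"
      by (simp add: space_PiM PiE_iff conj_commute)
  qed
  then have "emeasure (distr (lborel_power n) (lborel_power n) (\<lambda>s. \<lambda>i\<in>{..<n}. s (\<sigma> i))) (PiE {..<n} A) =
      (\<Prod>i<n. emeasure lborel (A (\<tau> i)))"
    using A \<sigma>\<tau> by (subst emeasure_distr[OF m]) (auto intro!: lborel_product.emeasure_PiM)
  also have "\<dots> = (\<Prod>i<n. emeasure lborel (A i))" by (rule prod.reindex_bij_betw[OF \<tau>])
  finally show "emeasure (distr (lborel_power n) (lborel_power n) (\<lambda>s. \<lambda>i\<in>{..<n}. s (\<sigma> i))) (PiE {..<n} A) =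
      (\<Prod>i<n. emeasure lborel (A i))" .
qed simp_all

lemma distr_lborel_power_map:
  fixes T :: "real \<Rightarrow> real"
  assumes [measurable]: "T \<in> borel_measurable borel" and T: "distr lborel lborel T = lborel"
  shows "distr (lborel_power n) (lborel_power n) (\<lambda>s. \<lambda>i\<in>{..<n}. T (s i)) = lborel_power n"
proof (rule lborel_product.PiM_eqI)
  fix A :: "nat \<Rightarrow> real set" assume A: "\<And>i. i \<in> {..<n} \<Longrightarrow> A i \<in> sets lborel"
  have m: "(\<lambda>s. \<lambda>i\<in>{..<n}. T (s i)) \<in> measurable (lborel_power n) (lborel_power n)"
    by measurable
  have "(\<lambda>s. \<lambda>i\<in>{..<n}. T (s i)) -` PiE {..<n} A \<inter> space (lborel_power n) = PiE {..<n} (\<lambda>i. T -` A i)"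
    by (rule set_eqI) (simp add: space_PiM PiE_iff conj_commute)
  moreover have "T -` A i \<in> sets lborel" if "i \<in> {..<n}" for i
    using measurable_sets[OF assms(1), of "A i"] A[OF that] by simp
  moreover have "emeasure lborel (T -` A i) = emeasure lborel (A i)" if "i \<in> {..<n}" for i
    using emeasure_distr[of T lborel lborel "A i"] A[OF that] by (simp add: T)
  moreover from calculation(2) have "emeasure (lborel_power n) (PiE {..<n} (\<lambda>i. T -` A i)) = (\<Prod>i<n. emeasure lborel (T -` A i))"
    by (intro lborel_product.emeasure_PiM) auto
  ultimately show "emeasure (distr (lborel_power n) (lborel_power n) (\<lambda>s. \<lambda>i\<in>{..<n}. T (s i))) (PiE {..<n} A) =
      (\<Prod>i<n. emeasure lborel (A i))"
    using A by (subst emeasure_distr[OF m]) simp_all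
qed simp_all

text \<open>This discards the discontinuity times of paths and the boundary times 0 and
  \<open>t\<close>.\<close>

lemma AE_lborel_power_notin_countable:
  assumes "countable D"
  shows "AE s in lborel_power n. \<forall>i<n. s i \<notin> D"
proof -
  have D: "D \<in> sets borel" by (rule sets.countable[OF _ assms]) auto
  have "AE s in lborel_power n. s i \<notin> D" if i: "i < n" for i
  proof (rule AE_I)
    let ?N = "PiE {..<n} (\<lambda>j. if j = i then D else UNIV)"
    show "?N \<in> sets (lborel_power n)" using D by (intro sets_PiM_I_finite) auto
    have "emeasure (lborel_power n) ?N = (\<Prod>j<n. emeasure lborel (if j = i then D else UNIV))"
      using D by (intro lborel_product.emeasure_PiM) auto
    also have "\<dots> = 0"
      using i emeasure_lborel_countable[OF assms] by (intro prod_zero) auto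
    finally show "emeasure (lborel_power n) ?N = 0" .
    show "{s \<in> space (lborel_power n). \<not> s i \<notin> D} \<subseteq> ?N"
      by (simp add: space_PiM PiE_iff subset_eq)
  qed
  then have "AE s in lborel_power n. \<forall>i\<in>{..<n}. s i \<notin> D"
    by (intro AE_finite_allI) auto
  then show ?thesis by (simp only: Ball_def lessThan_iff)
qed

text \<open>Being the identity outside \<open>{0..<t}\<close> makes it, for \<open>r\<close> in
  \<open>{0..t}\<close>, a measure-preserving map of the whole line, which then acts on the product
  measure coordinate by coordinate.\<close>

definition circle_rotation :: "real \<Rightarrow> real \<Rightarrow> real \<Rightarrow> real" where
  "circle_rotation t r u = (if 0 \<le> u \<and> u < t then (if u + r < t then u + r else u + r - t) else u)"

lemma borel_measurable_circle_rotation: "circle_rotation t r \<in> borel_measurable borel"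
  unfolding circle_rotation_def by measurable

lemma emeasure_lborel_vimage_plus:
  fixes A :: "real set"
  assumes "A \<in> sets borel"
  shows "emeasure lborel ((\<lambda>u. u + c) -` A) = emeasure lborel A"
proof -
  have "emeasure lborel A = emeasure (distr lborel borel ((+) c)) A" by (simp only: lborel_distr_plus)
  also have "\<dots> = emeasure lborel ((+) c -` A)" using assms by (subst emeasure_distr) auto
  finally show ?thesis by (simp add: add.commute[of c] vimage_def)
qed

text \<open>The map exchanges two intervals: \<open>{0..<t - r}\<close> goes to
  \<open>{r..<t}\<close> and \<open>{t - r..<t}\<close> to \<open>{0..<r}\<close>. \<open>?Y\<close>
  and \<open>?Z\<close> are the preimages of the corresponding parts of \<open>A\<close>, and
  \<open>?X\<close> is the part that stays fixed.\<close>

lemma distr_circle_rotation: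
  assumes r: "r \<in> {0..t}"
  shows "distr lborel lborel (circle_rotation t r) = lborel"
proof (rule measure_eqI)
  fix A assume "A \<in> sets (distr lborel lborel (circle_rotation t r))"
  then have A[measurable]: "A \<in> sets borel" by simp
  have v: "(\<lambda>u. u + c) -` B \<in> sets borel" if "B \<in> sets borel" for B :: "real set" and c
    using measurable_sets[of "\<lambda>u. u + c" borel borel B] that by simp
  let ?X = "A - {0..<t}" and ?Y = "(\<lambda>u. u + r) -` (A \<inter> {r..<t})" and ?Z = "(\<lambda>u. u + (r - t)) -` (A \<inter> {0..<r})"
  have "circle_rotation t r -` A = ?X \<union> (?Y \<union> ?Z)"
    using r by (auto simp: circle_rotation_def add_diff_eq split: if_splits)
  then have "emeasure lborel (circle_rotation t r -` A) = emeasure lborel (?X \<union> (?Y \<union> ?Z))" by simp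
  also have "\<dots> = emeasure lborel ?X + emeasure lborel (?Y \<union> ?Z)"
    using r by (intro plus_emeasure[symmetric]) (auto intro!: v sets.Un)
  also have "emeasure lborel (?Y \<union> ?Z) = emeasure lborel ?Y + emeasure lborel ?Z"
    using r by (intro plus_emeasure[symmetric]) (auto intro!: v)
  also have "\<dots> = emeasure lborel (A \<inter> {r..<t}) + emeasure lborel (A \<inter> {0..<r})"
    by (intro arg_cong2[where f = "(+)"] emeasure_lborel_vimage_plus) auto
  also have "\<dots> = emeasure lborel (A \<inter> {0..<t})"
    using r by (subst plus_emeasure) (auto intro!: arg_cong[where f = "emeasure lborel"])
  also have "emeasure lborel ?X + \<dots> = emeasure lborel A"
    by (subst plus_emeasure) (auto intro!: arg_cong[where f = "emeasure lborel"])
  finally show "emeasure (distr lborel lborel (circle_rotation t r)) A = emeasure lborel A"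
    using A borel_measurable_circle_rotation[of t r] by (subst emeasure_distr) auto
qed simp

section \<open>Cyclically ordered times\<close>

text \<open>\<open>m\<close> marks the only place where the increase may fail, that is, where the
  cyclic order passes the end of the time interval. It has to fail somewhere on the way round, so
  the sets for different \<open>m < n\<close> are disjoint.\<close>

definition broken_times :: "nat \<Rightarrow> real \<Rightarrow> nat \<Rightarrow> (nat \<Rightarrow> real) set" where
  "broken_times n t m = {s \<in> {..<n} \<rightarrow>\<^sub>E {0<..<t}. \<forall>i<n. i \<noteq> m \<longrightarrow> s i < s (Suc i mod n)}"

text \<open>Each fractional part is the fraction of a turn that leads forward from
  \<open>s (Suc i mod n)\<close> to \<open>s i\<close>, and depends only on the difference modulo
  \<open>t\<close>. Rotations of the circle map the half-open cube to itself, so invariance holds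
  without an exceptional set.\<close>

definition cyclic_times :: "nat \<Rightarrow> real \<Rightarrow> (nat \<Rightarrow> real) set" where
  "cyclic_times n t = {s \<in> {..<n} \<rightarrow>\<^sub>E {0..<t}. (\<Sum>i<n. frac ((s i - s (Suc i mod n)) / t)) = real (n - 1)}"

lemma bij_betw_add_mod: "bij_betw (\<lambda>i. (i + j) mod n) {..<n} {..<n::nat}"
proof (cases "n = 0")
  case False
  have "inj_on (\<lambda>i. (i + j) mod n) {..<n}"
  proof (rule linorder_inj_onI)
    fix i i' assume "i < i'" "i \<in> {..<n}" "i' \<in> {..<n}"
    then have "\<not> n dvd (i' + j) - (i + j)" by (auto dest: dvd_imp_le)
    then show "(i + j) mod n \<noteq> (i' + j) mod n"
      using \<open>i < i'\<close> mod_eq_dvd_iff_nat[of "i + j" "i' + j" n] by auto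
  qed auto
  moreover have "(\<lambda>i. (i + j) mod n) ` {..<n} \<subseteq> {..<n}" using False by auto
  ultimately show ?thesis by (simp add: bij_betw_def endo_inj_surj)
qed (simp add: bij_betw_def)

lemma strict_mono_on_lessThan_iff:
  fixes s :: "nat \<Rightarrow> 'a::order"
  shows "strict_mono_on {..<n} s \<longleftrightarrow> (\<forall>i. Suc i < n \<longrightarrow> s i < s (Suc i))"
proof
  assume *: "\<forall>i. Suc i < n \<longrightarrow> s i < s (Suc i)"
  have "s i < s j" if "i < j" "j < n" for i j
    using that(1)[THEN Suc_leI] that(2)
  proof (induction j rule: dec_induct)
    case (step k)
    then show ?case using * by (metis Suc_lessD less_trans)
  qed (use * in simp)
  then show "strict_mono_on {..<n} s" by (auto simp: strict_mono_on_def)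
qed (auto simp: strict_mono_on_def)

text \<open>Rotation by \<open>j\<close> brings the last coordinate to index
  \<open>n - Suc j\<close>, and with it the one comparison, from the last coordinate to the first,
  that the simplex does not impose.\<close>

lemma ordered_times_iff_broken:
  assumes j: "j < n" and s: "s \<in> extensional {..<n}"
  shows "s \<in> ordered_times n t \<longleftrightarrow> rotate_tuple n j s \<in> broken_times n t (n - Suc j)"
proof -
  define \<sigma> where "\<sigma> i = (i + j) mod n" for i
  have \<sigma>: "bij_betw \<sigma> {..<n} {..<n}" unfolding \<sigma>_def by (rule bij_betw_add_mod)
  have im: "\<sigma> ` {..<n} = {..<n}" using \<sigma> by (simp add: bij_betw_def)
  have all: "(\<forall>i\<in>{..<n}. P (\<sigma> i)) \<longleftrightarrow> (\<forall>i\<in>{..<n}. P i)" for P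
    using im by (metis image_eqI imageE)
  have last: "\<sigma> i = n - 1 \<longleftrightarrow> i = n - Suc j" "\<sigma> (Suc i mod n) = Suc (\<sigma> i) mod n" if "i < n" for i
    using that j by (auto simp: \<sigma>_def mod_if mod_Suc_eq mod_add_left_eq)
  have "(\<forall>i<n. i \<noteq> n - Suc j \<longrightarrow> rotate_tuple n j s i < rotate_tuple n j s (Suc i mod n)) \<longleftrightarrow>
      (\<forall>i\<in>{..<n}. \<sigma> i \<noteq> n - 1 \<longrightarrow> s (\<sigma> i) < s (Suc (\<sigma> i) mod n))"
    using j last by (auto simp: rotate_tuple_def \<sigma>_def)
  also have "\<dots> \<longleftrightarrow> (\<forall>i\<in>{..<n}. i \<noteq> n - 1 \<longrightarrow> s i < s (Suc i mod n))"
    by (rule all[of "\<lambda>i. i \<noteq> n - 1 \<longrightarrow> s i < s (Suc i mod n)"])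
  also have "\<dots> \<longleftrightarrow> strict_mono_on {..<n} s"
    unfolding strict_mono_on_lessThan_iff by (force simp: less_diff_conv)
  finally have 1: "(\<forall>i<n. i \<noteq> n - Suc j \<longrightarrow> rotate_tuple n j s i < rotate_tuple n j s (Suc i mod n)) \<longleftrightarrow>
      strict_mono_on {..<n} s" .
  have 2: "rotate_tuple n j s \<in> {..<n} \<rightarrow>\<^sub>E {0<..<t} \<longleftrightarrow> s \<in> {..<n} \<rightarrow>\<^sub>E {0<..<t}"
    using all[of "\<lambda>i. s i \<in> {0<..<t}"] s by (simp add: PiE_iff rotate_tuple_def \<sigma>_def)
  show ?thesis unfolding ordered_times_def broken_times_def using 1 2 by simp
qed

text \<open>With \<open>x\<^sub>i = (s\<^sub>i - s\<^sub>i\<^sub>+\<^sub>1) / t\<close> (indices mod \<open>n\<close>) the \<open>x\<^sub>i\<close> sum to \<open>0\<close>, so their fractional parts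
  sum to the number of ascents of \<open>s\<close>. The tuple is cyclically ordered iff this number is \<open>n - 1\<close>,
  a criterion that is visibly invariant under rotations of the circle.\<close>
lemma sum_indicator_broken_times:
  assumes n: "n \<ge> 1" and t: "t > 0" and s: "s \<in> {..<n} \<rightarrow>\<^sub>E {0<..<t}"
  shows "(\<Sum>m<n. indicator (broken_times n t m) s) = (indicator (cyclic_times n t) s :: real)"
proof -
  define x where "x i = (s i - s (Suc i mod n)) / t" for i
  define B where "B = {i \<in> {..<n}. \<not> s i < s (Suc i mod n)}"
  have s01: "0 < s i" "s i < t" if "i < n" for i using s that by (auto simp: PiE_iff)
  have "(\<Sum>i<n. s (Suc i mod n)) = (\<Sum>i<n. s i)"
    using sum.reindex_bij_betw[OF bij_betw_add_mod[of 1 n], of s] by simp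
  then have x0: "(\<Sum>i<n. x i) = 0"
    unfolding x_def by (simp add: sum_subtractf flip: sum_divide_distrib)
  have "frac (x i) = x i + (if i \<in> B then 0 else 1)" if i: "i < n" for i
  proof -
    have "Suc i mod n < n" using n by simp
    \<comment> \<open>An ascent puts \<open>x i\<close> strictly between -1 and 0, any other step
      into \<open>{0..<1}\<close>.\<close>
    then have "\<lfloor>x i\<rfloor> = (if i \<in> B then 0 else -1)"
      using s01[OF i] s01[of "Suc i mod n"] t i by (intro floor_unique) (auto simp: x_def B_def field_simps)
    then show ?thesis by (simp add: frac_def)
  qed
  then have "(\<Sum>i<n. frac (x i)) = (\<Sum>i<n. x i) + (\<Sum>i<n. if i \<in> B then 0 else 1)"
    by (simp add: sum.distrib)
  also have "(\<Sum>i<n. if i \<in> B then 0 else 1) = real (card ({..<n} - B))"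
    by (simp add: sum.If_cases Diff_eq)
  also have "card ({..<n} - B) = n - card B" by (subst card_Diff_subset) (auto simp: B_def)
  finally have "(\<Sum>i<n. frac (x i)) = real (n - card B)" using x0 by simp
  \<comment> \<open>Natural subtraction truncates; this bound is what lets
    \<open>n - card B = n - 1\<close> force \<open>card B = 1\<close>.\<close>
  moreover have "card B \<le> n" using card_mono[of "{..<n}" B] by (auto simp: B_def)
  moreover have "s \<in> {..<n} \<rightarrow>\<^sub>E {0..<t}" using s by (auto simp: PiE_iff less_imp_le)
  ultimately have cyc: "s \<in> cyclic_times n t \<longleftrightarrow> card B = 1"
    using n unfolding cyclic_times_def mem_Collect_eq x_def[symmetric] of_nat_eq_iff by auto
  \<comment> \<open>Membership in the \<open>m\<close>-th piece only says
    \<open>B \<subseteq> {m}\<close>; nonemptiness upgrades this to equality, so that at most one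
    piece contains \<open>s\<close>.\<close>
  have "B \<noteq> {}"
  proof
    assume "B = {}"
    then have "x i < 0" if "i < n" for i using that t by (auto simp: B_def x_def divide_neg_pos)
    then have "(\<Sum>i<n. x i) < (\<Sum>i<n. 0)" using n by (intro sum_strict_mono) (auto simp: lessThan_empty_iff)
    then show False using x0 by simp
  qed
  then have "s \<in> broken_times n t m \<longleftrightarrow> B = {m}" if "m < n" for m
    using s that by (auto simp: broken_times_def B_def)
  then have "(\<Sum>m<n. indicator (broken_times n t m) s) = (\<Sum>m<n. if B = {m} then 1 else 0 :: real)"
    by (intro sum.cong) (auto simp: indicator_def)
  also have "\<dots> = (if card B = 1 then 1 else 0)"
  proof (cases "card B = 1")
    case True
    then obtain b where b: "B = {b}" by (auto simp: card_1_singleton_iff)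
    then have "b < n" by (auto simp: B_def)
    then show ?thesis using b by simp
  next
    case False
    then have "B \<noteq> {m}" for m by auto
    then show ?thesis using False by simp
  qed
  finally show ?thesis using cyc by (simp add: indicator_def)
qed

section \<open>Measurability and integrability on the space of time tuples\<close>

lemma borel_measurable_lborel_power_component:
  "i < n \<Longrightarrow> (\<lambda>s. s i) \<in> borel_measurable (lborel_power n)"
  using measurable_component_singleton[of i "{..<n}" "\<lambda>_. lborel"] by simp

lemma broken_times_sets:
  assumes n: "n \<ge> 1"
  shows "broken_times n t m \<in> sets (lborel_power n)"
proof -
  have c: "(\<lambda>s. s i) \<in> borel_measurable (lborel_power n)" "(\<lambda>s. s (Suc i mod n)) \<in> borel_measurable (lborel_power n)"
    if "i < n" for i
    using n that by (auto intro!: borel_measurable_lborel_power_component)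
  have "{s \<in> space (lborel_power n). \<forall>i\<in>{..<n}. i \<noteq> m \<longrightarrow> s i < s (Suc i mod n)} \<in> sets (lborel_power n)"
  proof (rule sets.sets_Collect_finite_All)
    fix i assume i: "i \<in> {..<n}"
    show "{s \<in> space (lborel_power n). i \<noteq> m \<longrightarrow> s i < s (Suc i mod n)} \<in> sets (lborel_power n)"
    proof (cases "i = m")
      case False
      then show ?thesis using i borel_measurable_less[OF c] by simp
    qed simp
  qed simp
  then have "PiE {..<n} (\<lambda>_. {0<..<t}) \<inter>
      {s \<in> space (lborel_power n). \<forall>i\<in>{..<n}. i \<noteq> m \<longrightarrow> s i < s (Suc i mod n)} \<in> sets (lborel_power n)"
    by (intro sets.Int sets_PiM_I_finite) simp_all
  also have "PiE {..<n} (\<lambda>_. {0<..<t}) \<inter>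
      {s \<in> space (lborel_power n). \<forall>i\<in>{..<n}. i \<noteq> m \<longrightarrow> s i < s (Suc i mod n)} = broken_times n t m"
    by (rule set_eqI) (auto simp: broken_times_def space_PiM PiE_iff)
  finally show ?thesis .
qed

lemma cyclic_times_sets:
  assumes n: "n \<ge> 1"
  shows "cyclic_times n t \<in> sets (lborel_power n)"
proof -
  have fr: "frac \<in> borel_measurable (borel :: real measure)"
    unfolding frac_def by measurable
  have "(\<lambda>s. \<Sum>i<n. frac ((s i - s (Suc i mod n)) / t)) \<in> borel_measurable (lborel_power n)"
    using n by (intro borel_measurable_sum measurable_compose[OF _ fr] borel_measurable_divide
      borel_measurable_diff borel_measurable_lborel_power_component borel_measurable_const) auto
  then have "{s \<in> space (lborel_power n). (\<Sum>i<n. frac ((s i - s (Suc i mod n)) / t)) = real (n - 1)} \<in> sets (lborel_power n)"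
    by (intro borel_measurable_eq borel_measurable_const)
  then have "PiE {..<n} (\<lambda>_. {0..<t}) \<inter>
      {s \<in> space (lborel_power n). (\<Sum>i<n. frac ((s i - s (Suc i mod n)) / t)) = real (n - 1)} \<in> sets (lborel_power n)"
    by (intro sets.Int sets_PiM_I_finite) simp_all
  also have "PiE {..<n} (\<lambda>_. {0..<t}) \<inter>
      {s \<in> space (lborel_power n). (\<Sum>i<n. frac ((s i - s (Suc i mod n)) / t)) = real (n - 1)} = cyclic_times n t"
    by (rule set_eqI) (auto simp: cyclic_times_def space_PiM PiE_iff)
  finally show ?thesis .
qed

lemma ordered_times_eq_broken: "n \<ge> 1 \<Longrightarrow> ordered_times n t = broken_times n t (n - 1)"
proof (rule set_eqI)
  fix s :: "nat \<Rightarrow> real" assume n: "n \<ge> 1"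
  have "rotate_tuple n 0 s = s" if "s \<in> extensional {..<n}"
    unfolding rotate_tuple_def using that by (auto simp: extensional_def restrict_def)
  then show "s \<in> ordered_times n t \<longleftrightarrow> s \<in> broken_times n t (n - 1)"
    using ordered_times_iff_broken[of 0 n s t] n
    by (auto simp: ordered_times_def broken_times_def PiE_def)
qed

lemma ordered_times_sets: "n \<ge> 1 \<Longrightarrow> ordered_times n t \<in> sets (lborel_power n)"
  by (simp add: ordered_times_eq_broken broken_times_sets)

lemma emeasure_lborel_power_cube: "emeasure (lborel_power n) (PiE {..<n} (\<lambda>_. {0..K})) < \<infinity>"
proof -
  have "emeasure (lborel_power n) (PiE {..<n} (\<lambda>_. {0..K})) = (\<Prod>i<n. ennreal (max 0 K))"
    by (subst lborel_product.emeasure_PiM) (auto simp: emeasure_lborel_Icc_eq max_def)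
  then show ?thesis by (simp add: prod_ennreal power_less_top_ennreal)
qed

lemma integrable_lborel_power:
  fixes h :: "(nat \<Rightarrow> real) \<Rightarrow> real"
  assumes "h \<in> borel_measurable (lborel_power n)"
    and "\<And>s. s \<in> space (lborel_power n) \<Longrightarrow> \<bar>h s\<bar> \<le> C"
    and "\<And>s. h s \<noteq> 0 \<Longrightarrow> s \<in> PiE {..<n} (\<lambda>_. {0..K})"
  shows "integrable (lborel_power n) h"
proof (rule integrableI_bounded_set[where B = C])
  show "PiE {..<n} (\<lambda>_. {0..K}) \<in> sets (lborel_power n)" by (intro sets_PiM_I_finite) auto
  show "AE s in lborel_power n. s \<in> PiE {..<n} (\<lambda>_. {0..K}) \<longrightarrow> norm (h s) \<le> C"
    using assms(2) by (intro AE_I2) simp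
  show "AE s in lborel_power n. s \<notin> PiE {..<n} (\<lambda>_. {0..K}) \<longrightarrow> h s = 0"
    using assms(3) by (intro AE_I2) blast
qed (use assms emeasure_lborel_power_cube in auto)

lemma measurable_path_tuple:
  fixes Q :: "real \<Rightarrow> 'a::second_countable_topology"
  assumes Q: "Q \<in> borel_measurable borel"
  shows "(\<lambda>s. \<lambda>i\<in>{..<n}. Q (s i)) \<in> measurable (lborel_power n) (borel_of (power_topology n))"
proof (rule measurable_into_power)
  fix i assume "i < n"
  then have "(\<lambda>s. s i) \<in> measurable (lborel_power n) borel"
    by (rule borel_measurable_lborel_power_component)
  then show "(\<lambda>s. Q (s i)) \<in> borel_measurable (lborel_power n)"
    using Q by (rule measurable_compose)
qed

lemma measurable_rotate_tuple:
  "n \<ge> 1 \<Longrightarrow> rotate_tuple n j \<in> measurable (lborel_power n) (lborel_power n)"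
  unfolding rotate_tuple_def by (intro measurable_restrict measurable_component_singleton) auto

text \<open>Substituting the index rotation in the \<open>j\<close>-th integral moves the rotation
  from the argument of \<open>f\<close> to the domain; the resulting domains are the pieces that
  make up \<open>cyclic_times\<close>.\<close>

lemma multi_occ_eq_cyclic:
  fixes Q :: "real \<Rightarrow> 'a::second_countable_topology"
  assumes n: "n \<ge> 1" and t: "t > 0" and Q: "Q \<in> borel_measurable borel"
    and f: "f \<in> borel_measurable (borel_of (power_topology n))"
    and C: "\<And>z. z \<in> topspace (power_topology n) \<Longrightarrow> \<bar>f z\<bar> \<le> C"
  shows "multi_occ n (t, Q) f =
    (\<integral>s. indicator (cyclic_times n t) s * f (\<lambda>i\<in>{..<n}. Q (s i)) \<partial>lborel_power n)"
proof -
  let ?M = "lborel_power n"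
  define g where "g s = f (\<lambda>i\<in>{..<n}. Q (s i))" for s
  have g: "g \<in> borel_measurable ?M"
    unfolding g_def using measurable_path_tuple[OF Q] f by (rule measurable_compose)
  have gC: "\<bar>g s\<bar> \<le> C" for s unfolding g_def by (rule C) (simp add: topspace_power_topology)
  have C0: "0 \<le> C" using gC[of undefined] by linarith
  have broken: "broken_times n t m \<in> sets ?M" for m using n by (rule broken_times_sets)
  have meas: "(\<lambda>s. indicator (broken_times n t m) s * g s) \<in> borel_measurable ?M" for m
    using g broken by (intro borel_measurable_times) auto
  have int: "integrable ?M (\<lambda>s. indicator (broken_times n t m) s * g s)" for m
    using gC C0
    by (intro integrable_lborel_power[where C = C and K = t] meas)
      (auto simp: indicator_def broken_times_def PiE_iff less_imp_le split: if_splits)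
  have "(LINT s:ordered_times n t|?M. f (rotate_tuple n j (\<lambda>i\<in>{..<n}. Q (s i)))) =
      (\<integral>s. indicator (broken_times n t (n - Suc j)) s * g s \<partial>?M)" if j: "j < n" for j
  proof -
    have "rotate_tuple n j (\<lambda>i\<in>{..<n}. Q (s i)) = (\<lambda>i\<in>{..<n}. Q (rotate_tuple n j s i))" for s
      using n by (auto simp: rotate_tuple_def restrict_def)
    then have eq: "indicator (ordered_times n t) s * f (rotate_tuple n j (\<lambda>i\<in>{..<n}. Q (s i))) =
        indicator (broken_times n t (n - Suc j)) (rotate_tuple n j s) * g (rotate_tuple n j s)"
      if "s \<in> space ?M" for s
      using that ordered_times_iff_broken[OF j, of s t]
      by (auto simp: g_def indicator_def space_PiM PiE_def)
    have "(LINT s:ordered_times n t|?M. f (rotate_tuple n j (\<lambda>i\<in>{..<n}. Q (s i)))) =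
        (\<integral>s. indicator (broken_times n t (n - Suc j)) (rotate_tuple n j s) * g (rotate_tuple n j s) \<partial>?M)"
      unfolding set_lebesgue_integral_def real_scaleR_def
      by (rule Bochner_Integration.integral_cong[OF refl eq])
    also have "\<dots> = (\<integral>s. indicator (broken_times n t (n - Suc j)) s * g s \<partial>distr ?M ?M (rotate_tuple n j))"
      by (rule integral_distr[symmetric, OF measurable_rotate_tuple[OF n] meas])
    also have "distr ?M ?M (rotate_tuple n j) = ?M"
      using distr_lborel_power_reindex[OF bij_betw_add_mod, of n j] by (simp add: rotate_tuple_def[abs_def])
    finally show ?thesis .
  qed
  then have "multi_occ n (t, Q) f = (\<Sum>j<n. \<integral>s. indicator (broken_times n t (n - Suc j)) s * g s \<partial>?M)"
    by (simp add: multi_occ_def)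
  also have "\<dots> = (\<Sum>m<n. \<integral>s. indicator (broken_times n t m) s * g s \<partial>?M)"
    by (rule sum.nat_diff_reindex)
  also have "\<dots> = (\<integral>s. (\<Sum>m<n. indicator (broken_times n t m) s * g s) \<partial>?M)"
    using int by (intro Bochner_Integration.integral_sum[symmetric])
  also have "\<dots> = (\<integral>s. indicator (cyclic_times n t) s * g s \<partial>?M)"
  proof (rule integral_cong_AE)
    \<comment> \<open>The pieces use the open interval and \<open>cyclic_times\<close> the half-open
      one, so they disagree only where some coordinate is 0.\<close>
    have "AE s in ?M. \<forall>i<n. s i \<notin> {0}" by (rule AE_lborel_power_notin_countable) simp
    then show "AE s in ?M. (\<Sum>m<n. indicator (broken_times n t m) s * g s) = indicator (cyclic_times n t) s * g s"
    proof eventually_elim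
      case (elim s)
      show ?case
      proof (cases "s \<in> {..<n} \<rightarrow>\<^sub>E {0<..<t}")
        case True
        then show ?thesis
          using sum_indicator_broken_times[OF n t True] by (simp flip: sum_distrib_right)
      next
        case False
        have "s \<notin> cyclic_times n t"
        proof
          assume "s \<in> cyclic_times n t"
          then have "s \<in> {..<n} \<rightarrow>\<^sub>E {0..<t}" by (simp add: cyclic_times_def)
          then have "s \<in> {..<n} \<rightarrow>\<^sub>E {0<..<t}" using elim by (force simp: PiE_iff order_less_le)
          then show False using False by simp
        qed
        then show ?thesis using False by (simp add: broken_times_def)
      qed
    qed
    show "(\<lambda>s. indicator (cyclic_times n t) s * g s) \<in> borel_measurable ?M"
      using cyclic_times_sets[OF n] g by (intro borel_measurable_times) auto
  qed (intro borel_measurable_sum meas)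
  finally show ?thesis by (simp add: g_def)
qed

section \<open>Invariance under rotations of the circle\<close>

lemma circle_rotation_eq: "\<exists>k::int. circle_rotation t r u = u + r + t * of_int k" if "0 \<le> u" "u < t"
proof (cases "u + r < t")
  case True
  then show ?thesis using that by (intro exI[of _ 0]) (simp add: circle_rotation_def)
next
  case False
  then show ?thesis using that by (intro exI[of _ "-1"]) (simp add: circle_rotation_def)
qed

text \<open>Rotation is translation by \<open>r\<close> modulo \<open>t\<close>, so differences of
  coordinates change by whole multiples of \<open>t\<close> and every fractional part in the
  criterion survives. It preserves both \<open>{0..<t}\<close> and its complement, which gives the
  two directions.\<close>

lemma circle_rotation_cyclic_times:
  assumes n: "n \<ge> 1" and t: "t > 0" and r: "r \<in> {0..t}" and s: "s \<in> extensional {..<n}"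
  shows "(\<lambda>i\<in>{..<n}. circle_rotation t r (s i)) \<in> cyclic_times n t \<longleftrightarrow> s \<in> cyclic_times n t"
proof -
  let ?T = "circle_rotation t r"
  have range: "0 \<le> ?T u \<and> ?T u < t \<longleftrightarrow> 0 \<le> u \<and> u < t" for u
    using r by (auto simp: circle_rotation_def)
  have frac: "frac ((?T u - ?T v) / t) = frac ((u - v) / t)"
    if uv: "0 \<le> u" "u < t" "0 \<le> v" "v < t" for u v
  proof -
    obtain k where k: "?T u = u + r + t * of_int k" using circle_rotation_eq[OF uv(1,2), of r] ..
    obtain l where l: "?T v = v + r + t * of_int l" using circle_rotation_eq[OF uv(3,4), of r] ..
    have "(?T u - ?T v) / t = (u - v) / t + of_int (k - l)"
      using t unfolding k l by (simp add: field_simps)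
    then show ?thesis by (simp add: frac_def)
  qed
  have "(\<Sum>i<n. frac (((\<lambda>i\<in>{..<n}. ?T (s i)) i - (\<lambda>i\<in>{..<n}. ?T (s i)) (Suc i mod n)) / t)) =
      (\<Sum>i<n. frac ((s i - s (Suc i mod n)) / t))" if "\<forall>i<n. 0 \<le> s i \<and> s i < t"
  proof (rule sum.cong[OF refl])
    fix i assume "i \<in> {..<n}"
    then have "i < n" "Suc i mod n < n" by auto
    then show "frac (((\<lambda>i\<in>{..<n}. ?T (s i)) i - (\<lambda>i\<in>{..<n}. ?T (s i)) (Suc i mod n)) / t) =
        frac ((s i - s (Suc i mod n)) / t)"
      using that frac[of "s i" "s (Suc i mod n)"] by simp
  qed
  moreover have "(\<lambda>i\<in>{..<n}. ?T (s i)) \<in> {..<n} \<rightarrow>\<^sub>E {0..<t} \<longleftrightarrow> (\<forall>i<n. 0 \<le> s i \<and> s i < t)"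
    "s \<in> {..<n} \<rightarrow>\<^sub>E {0..<t} \<longleftrightarrow> (\<forall>i<n. 0 \<le> s i \<and> s i < t)"
    using s range by (simp_all add: PiE_iff Ball_def)
  ultimately show ?thesis
    unfolding cyclic_times_def mem_Collect_eq by (cases "\<forall>i<n. 0 \<le> s i \<and> s i < t") (simp_all only: simp_thms)
qed

text \<open>Substitution by the circle rotation: it preserves Lebesgue measure and
  \<open>cyclic_times\<close>, and on \<open>{0..<t}\<close> it is translation by \<open>r\<close>
  up to a period of \<open>Q\<close>. The endpoint \<open>r = t\<close> is included because limits
  of shifts from \<open>{0..<t}\<close> can reach it.\<close>

lemma multi_occ_shift:
  fixes Q :: "real \<Rightarrow> 'a::second_countable_topology"
  assumes n: "n \<ge> 1" and t: "t > 0" and Q: "Q \<in> borel_measurable borel"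
    and per: "\<And>x. Q (x + t) = Q x" and r: "r \<in> {0..t}"
    and f: "f \<in> borel_measurable (borel_of (power_topology n))"
    and C: "\<And>z. z \<in> topspace (power_topology n) \<Longrightarrow> \<bar>f z\<bar> \<le> C"
  shows "multi_occ n (t, \<lambda>u. Q (u + r)) f = multi_occ n (t, Q) f"
proof -
  let ?M = "lborel_power n" and ?T = "circle_rotation t r"
  let ?h = "\<lambda>s. indicator (cyclic_times n t) s * f (\<lambda>i\<in>{..<n}. Q (s i))"
  have Qr: "(\<lambda>u. Q (u + r)) \<in> borel_measurable borel"
    using Q by (rule measurable_compose[rotated]) simp
  have T: "(\<lambda>s. \<lambda>i\<in>{..<n}. ?T (s i)) \<in> measurable ?M ?M"
    using borel_measurable_circle_rotation[measurable] by measurable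
  have QT: "Q (?T u) = Q (u + r)" if "0 \<le> u" "u < t" for u
    using that per[of "u + r - t"] by (simp add: circle_rotation_def)
  have h: "?h \<in> borel_measurable ?M"
    using cyclic_times_sets[OF n] measurable_compose[OF measurable_path_tuple[OF Q] f]
    by (intro borel_measurable_times) auto
  have "multi_occ n (t, \<lambda>u. Q (u + r)) f =
      (\<integral>s. indicator (cyclic_times n t) s * f (\<lambda>i\<in>{..<n}. Q (s i + r)) \<partial>?M)"
    by (rule multi_occ_eq_cyclic[OF n t Qr f C])
  also have "\<dots> = (\<integral>s. ?h (\<lambda>i\<in>{..<n}. ?T (s i)) \<partial>?M)"
  proof (rule Bochner_Integration.integral_cong[OF refl])
    fix s assume "s \<in> space ?M"
    then have e: "s \<in> extensional {..<n}" by (simp add: space_PiM PiE_def)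
    show "indicator (cyclic_times n t) s * f (\<lambda>i\<in>{..<n}. Q (s i + r)) = ?h (\<lambda>i\<in>{..<n}. ?T (s i))"
    proof (cases "s \<in> cyclic_times n t")
      case True
      then have "(\<lambda>i\<in>{..<n}. Q ((\<lambda>i\<in>{..<n}. ?T (s i)) i)) = (\<lambda>i\<in>{..<n}. Q (s i + r))"
        by (intro restrict_ext) (auto simp: cyclic_times_def PiE_iff QT)
      then show ?thesis using circle_rotation_cyclic_times[OF n t r e] by (simp only: indicator_def)
    next
      case False
      then show ?thesis using circle_rotation_cyclic_times[OF n t r e] by simp
    qed
  qed
  also have "\<dots> = (\<integral>s. ?h s \<partial>distr ?M ?M (\<lambda>s. \<lambda>i\<in>{..<n}. ?T (s i)))"
    by (rule integral_distr[symmetric, OF T h])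
  also have "distr ?M ?M (\<lambda>s. \<lambda>i\<in>{..<n}. ?T (s i)) = ?M"
    by (rule distr_lborel_power_map[OF borel_measurable_circle_rotation distr_circle_rotation[OF r]])
  also have "(\<integral>s. ?h s \<partial>?M) = multi_occ n (t, Q) f"
    by (rule multi_occ_eq_cyclic[OF n t Q f C, symmetric])
  finally show ?thesis .
qed

section \<open>The multi-occupation field on loops\<close>

lemma multi_occ_cong:
  assumes "\<And>u. 0 < u \<Longrightarrow> u < t \<Longrightarrow> p u = q u"
  shows "multi_occ n (t, p) f = multi_occ n (t, q) f"
proof -
  have "(\<lambda>i\<in>{..<n}. p (s i)) = (\<lambda>i\<in>{..<n}. q (s i))" if "s \<in> ordered_times n t" for s
    using that assms by (intro restrict_ext) (auto simp: ordered_times_def PiE_iff)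
  then have "indicator (ordered_times n t) s *\<^sub>R f (rotate_tuple n j (\<lambda>i\<in>{..<n}. p (s i))) =
      indicator (ordered_times n t) s *\<^sub>R f (rotate_tuple n j (\<lambda>i\<in>{..<n}. q (s i)))" for s j
    by (cases "s \<in> ordered_times n t") simp_all
  then show ?thesis unfolding multi_occ_def set_lebesgue_integral_def fst_conv snd_conv by (simp only:)
qed

lemma multi_occ_periodic_ext: "multi_occ n (t, periodic_ext t p) f = multi_occ n (t, p) f"
  by (rule multi_occ_cong) (simp add: periodic_ext_eq)

lemma in_loops_based: "L \<in> loops \<Longrightarrow> l \<in> L \<Longrightarrow> l \<in> based_loops"
  unfolding loops_def using in_quotient_imp_subset[OF equiv_loop_rel] by blast

lemma in_loops_shift:
  assumes "L \<in> loops" "l \<in> L" "l' \<in> L"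
  obtains r where "r \<in> {0..<fst l}" "l' = circ_shift r l"
proof -
  have "(l, l') \<in> loop_rel"
    using in_quotient_imp_in_rel[OF equiv_loop_rel] assms unfolding loops_def by blast
  then show ?thesis using that by (auto simp: loop_rel_def)
qed

lemma in_loops_nonempty: "L \<in> loops \<Longrightarrow> \<exists>l. l \<in> L"
  unfolding loops_def using in_quotient_imp_non_empty[OF equiv_loop_rel] by blast

lemma multi_occ_shifted_ext:
  fixes p :: "real \<Rightarrow> 'a::polish_space"
  assumes n: "n \<ge> 1" and l: "(t, p) \<in> based_loops" and r: "r \<in> {0..t}"
    and f: "f \<in> borel_measurable (borel_of (power_topology n))"
    and C: "\<And>z. z \<in> topspace (power_topology n) \<Longrightarrow> \<bar>f z\<bar> \<le> C"
  shows "multi_occ n (t, \<lambda>u. periodic_ext t p (u + r)) f = multi_occ n (t, p) f"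
proof -
  have "multi_occ n (t, \<lambda>u. periodic_ext t p (u + r)) f = multi_occ n (t, periodic_ext t p) f"
    by (rule multi_occ_shift[OF n based_loop_duration_pos[OF l] borel_measurable_periodic_ext[OF l]
        periodic_ext_period[OF based_loop_duration_pos[OF l]] r f C])
  then show ?thesis by (simp only: multi_occ_periodic_ext)
qed

text \<open>This is well-definedness: \<open>the_elem\<close> returns the common value only if the
  image of the class is a singleton. Representatives are circular shifts of one another, which
  become translations of one periodic extension.\<close>

lemma loop_multi_occ_eq:
  fixes L :: "'a::polish_space timed_path set"
  assumes n: "n \<ge> 1" and L: "L \<in> loops" and l: "l \<in> L"
    and f: "f \<in> borel_measurable (borel_of (power_topology n))"
    and C: "\<And>z. z \<in> topspace (power_topology n) \<Longrightarrow> \<bar>f z\<bar> \<le> C"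
  shows "loop_multi_occ n L f = multi_occ n l f"
proof -
  obtain t p where tp: "l = (t, p)" by force
  have b: "(t, p) \<in> based_loops" using in_loops_based[OF L l] tp by simp
  have "multi_occ n l' f = multi_occ n l f" if l': "l' \<in> L" for l'
  proof -
    obtain r where r: "r \<in> {0..<t}" "l' = circ_shift r l"
      using in_loops_shift[OF L l l'] tp by auto
    have "l' = (t, snd l')" unfolding r tp circ_shift_def by simp
    then have "multi_occ n l' f = multi_occ n (t, snd l') f" by simp
    also have "\<dots> = multi_occ n (t, \<lambda>u. periodic_ext t p (u + r)) f"
      unfolding r tp by (rule multi_occ_cong, rule snd_circ_shift[OF based_loop_duration_pos[OF b] based_loop_endpoints[OF b]]) (use r in auto)
    also have "\<dots> = multi_occ n l f"
      unfolding tp by (rule multi_occ_shifted_ext[OF n b _ f C]) (use r in auto)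
    finally show ?thesis .
  qed
  then have "(\<lambda>l. multi_occ n l f) ` L = {multi_occ n l f}" using l by blast
  then show ?thesis by (simp add: loop_multi_occ_def)
qed

text \<open>The measure is the image of Lebesgue measure on \<open>cyclic_times\<close> under the
  path of one representative. It is chosen before \<open>f\<close>, so that dominated convergence
  applies when \<open>f\<close> varies and the loop is fixed.\<close>

lemma loop_multi_occ_as_integral:
  fixes L :: "'a::polish_space timed_path set"
  assumes n: "n \<ge> 1" and L: "L \<in> loops"
  shows "\<exists>\<kappa>. finite_measure \<kappa> \<and> sets \<kappa> = sets (borel_of (power_topology n)) \<and>
    (\<forall>f C. f \<in> borel_measurable (borel_of (power_topology n)) \<longrightarrow>
      (\<forall>z\<in>topspace (power_topology n). \<bar>f z\<bar> \<le> C) \<longrightarrow> loop_multi_occ n L f = (\<integral>z. f z \<partial>\<kappa>))"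
proof -
  obtain t p where l: "(t, p) \<in> L" using in_loops_nonempty[OF L] by force
  have b: "(t, p) \<in> based_loops" using L l by (rule in_loops_based)
  let ?M = "lborel_power n" and ?N = "borel_of (power_topology n)" and ?c = "cyclic_times n t"
  define Z where "Z s = (\<lambda>i\<in>{..<n}. periodic_ext t p (s i))" for s
  define \<kappa> where "\<kappa> = distr (restrict_space ?M ?c) ?N Z"
  have c: "?c \<in> sets ?M" using n by (rule cyclic_times_sets)
  have Z: "Z \<in> measurable ?M ?N"
    unfolding Z_def by (rule measurable_path_tuple[OF borel_measurable_periodic_ext[OF b]])
  have Z': "Z \<in> measurable (restrict_space ?M ?c) ?N"
    using Z by (rule measurable_restrict_space1)
  have "?c \<subseteq> PiE {..<n} (\<lambda>_. {0..<t})" by (auto simp: cyclic_times_def)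
  also have "\<dots> \<subseteq> PiE {..<n} (\<lambda>_. {0..t})" by (rule PiE_mono) auto
  finally have "emeasure ?M ?c \<le> emeasure ?M (PiE {..<n} (\<lambda>_. {0..t}))"
    by (rule emeasure_mono) (intro sets_PiM_I_finite, simp_all)
  then have "emeasure ?M ?c < \<infinity>" using emeasure_lborel_power_cube by (rule le_less_trans)
  then have "finite_measure (restrict_space ?M ?c)"
    using c sets.sets_into_space[OF c]
    by (intro finite_measureI) (auto simp: emeasure_restrict_space space_restrict_space Int_absorb1)
  then have "finite_measure \<kappa>" unfolding \<kappa>_def using Z' by (rule finite_measure.finite_measure_distr)
  moreover have "sets \<kappa> = sets ?N" by (simp add: \<kappa>_def)
  moreover have "loop_multi_occ n L f = (\<integral>z. f z \<partial>\<kappa>)"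
    if f: "f \<in> borel_measurable ?N" and C: "\<forall>z\<in>topspace (power_topology n). \<bar>f z\<bar> \<le> C" for f C
  proof -
    have "loop_multi_occ n L f = multi_occ n (t, p) f"
      by (rule loop_multi_occ_eq[OF n L l f]) (use C in blast)
    also have "\<dots> = multi_occ n (t, periodic_ext t p) f" by (rule multi_occ_periodic_ext[symmetric])
    also have "\<dots> = (\<integral>s. indicator ?c s * f (Z s) \<partial>?M)"
      unfolding Z_def
      by (rule multi_occ_eq_cyclic[OF n based_loop_duration_pos[OF b] borel_measurable_periodic_ext[OF b] f]) (use C in blast)
    also have "\<dots> = (\<integral>s. f (Z s) \<partial>restrict_space ?M ?c)"
      using c by (subst integral_restrict_space) (auto simp: sets.Int_space_eq2)
    also have "\<dots> = (\<integral>z. f z \<partial>\<kappa>)" unfolding \<kappa>_def by (rule integral_distr[symmetric, OF Z' f])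
    finally show ?thesis .
  qed
  ultimately show ?thesis by blast
qed

section \<open>Continuity in the loop for products of continuous functions\<close>

lemma multi_occ_tendsto:
  fixes g :: "nat \<Rightarrow> 'a::polish_space \<Rightarrow> real" and Q :: "real \<Rightarrow> 'a" and R :: "nat \<Rightarrow> real \<Rightarrow> 'a"
  assumes n: "n \<ge> 1"
    and g: "\<And>i. continuous_on UNIV (g i)" "\<And>i x. 0 \<le> g i x" "\<And>i x. g i x \<le> 1"
    and T: "T \<longlonglongrightarrow> t"
    and meas: "\<And>k. R k \<in> borel_measurable borel" "Q \<in> borel_measurable borel"
    and D: "countable D" and R: "\<And>s. 0 < s \<Longrightarrow> s < t \<Longrightarrow> s \<notin> D \<Longrightarrow> (\<lambda>k. R k s) \<longlonglongrightarrow> Q s"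
  shows "(\<lambda>k. multi_occ n (T k, R k) (\<lambda>z. \<Prod>i<n. g i (z i))) \<longlonglongrightarrow> multi_occ n (t, Q) (\<lambda>z. \<Prod>i<n. g i (z i))"
proof -
  let ?M = "lborel_power n" and ?f = "\<lambda>z. \<Prod>i<n. g i (z i)"
  have f01: "0 \<le> ?f z" "?f z \<le> 1" for z using g by (auto intro!: prod_nonneg prod_le_1)
  have fm: "?f \<in> borel_measurable (borel_of (power_topology n))"
    using g(1) by (intro borel_measurable_prod measurable_power_component borel_measurable_continuous_onI) auto
  \<comment> \<open>Converging durations are bounded, so one cube of side \<open>K\<close> contains
    all the domains and its indicator is a common majorant.\<close>
  have "Bseq T" using T convergentI convergent_imp_Bseq by blast
  then obtain K where K: "\<And>k. \<bar>T k\<bar> \<le> K" unfolding Bseq_def by auto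
  have rot: "rotate_tuple n j (\<lambda>i\<in>{..<n}. P (s i)) = (\<lambda>i\<in>{..<n}. P (rotate_tuple n j s i))"
    for P :: "real \<Rightarrow> 'a" and s j using n by (auto simp: rotate_tuple_def restrict_def)
  have hm: "(\<lambda>s. indicator (ordered_times n u) s * ?f (rotate_tuple n j (\<lambda>i\<in>{..<n}. P (s i)))) \<in> borel_measurable ?M"
    if "P \<in> borel_measurable borel" for P u j
    unfolding rot using ordered_times_sets[OF n]
    by (intro borel_measurable_times borel_measurable_indicator
        measurable_compose[OF measurable_compose[OF measurable_rotate_tuple[OF n] measurable_path_tuple[OF that]] fm])
  have "(\<lambda>k. \<integral>s. indicator (ordered_times n (T k)) s * ?f (rotate_tuple n j (\<lambda>i\<in>{..<n}. R k (s i))) \<partial>?M)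
      \<longlonglongrightarrow> (\<integral>s. indicator (ordered_times n t) s * ?f (rotate_tuple n j (\<lambda>i\<in>{..<n}. Q (s i))) \<partial>?M)" for j
  proof (rule integral_dominated_convergence[where w = "indicator (PiE {..<n} (\<lambda>_. {0..K}))"])
    show "integrable ?M (indicator (PiE {..<n} (\<lambda>_. {0..K})) :: _ \<Rightarrow> real)"
      using emeasure_lborel_power_cube[of n K] by (intro integrable_real_indicator sets_PiM_I_finite) auto
    show "AE s in ?M. norm (indicator (ordered_times n (T k)) s * ?f (rotate_tuple n j (\<lambda>i\<in>{..<n}. R k (s i))))
        \<le> indicator (PiE {..<n} (\<lambda>_. {0..K})) s" for k
    proof (rule AE_I2)
      fix s
      have "s \<in> PiE {..<n} (\<lambda>_. {0..K})" if "s \<in> ordered_times n (T k)"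
      proof -
        have "s \<in> PiE {..<n} (\<lambda>_. {0<..<T k})" using that by (simp add: ordered_times_def)
        moreover have "PiE {..<n} (\<lambda>_. {0<..<T k}) \<subseteq> PiE {..<n} (\<lambda>_. {0..K})"
          using K[of k] by (intro PiE_mono) auto
        ultimately show ?thesis by blast
      qed
      then show "norm (indicator (ordered_times n (T k)) s * ?f (rotate_tuple n j (\<lambda>i\<in>{..<n}. R k (s i))))
          \<le> indicator (PiE {..<n} (\<lambda>_. {0..K})) s"
        using f01[of "rotate_tuple n j (\<lambda>i\<in>{..<n}. R k (s i))"]
        by (cases "s \<in> ordered_times n (T k)") simp_all
    qed
    \<comment> \<open>Where \<open>s i = t\<close>, the comparison \<open>s i < T k\<close> could
      oscillate with \<open>k\<close>; elsewhere it is eventually constant. Avoiding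
      \<open>D\<close> secures convergence of the paths.\<close>
    have "AE s in ?M. \<forall>i<n. s i \<notin> insert t D"
      using D by (intro AE_lborel_power_notin_countable) simp
    then show "AE s in ?M. (\<lambda>k. indicator (ordered_times n (T k)) s * ?f (rotate_tuple n j (\<lambda>i\<in>{..<n}. R k (s i))))
        \<longlonglongrightarrow> indicator (ordered_times n t) s * ?f (rotate_tuple n j (\<lambda>i\<in>{..<n}. Q (s i)))"
    proof eventually_elim
      case (elim s)
      have "\<forall>\<^sub>F k in sequentially. s i < T k \<longleftrightarrow> s i < t" if "i \<in> {..<n}" for i
      proof (cases "s i < t")
        case True
        then show ?thesis using order_tendstoD(1)[OF T] by (auto elim: eventually_mono)
      next
        case False
        then have "t < s i" using elim that by force
        then have "\<forall>\<^sub>F k in sequentially. T k < s i" by (rule order_tendstoD(2)[OF T])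
        then show ?thesis using False by (auto elim!: eventually_mono)
      qed
      then have "\<forall>\<^sub>F k in sequentially. \<forall>i\<in>{..<n}. s i < T k \<longleftrightarrow> s i < t"
        by (intro eventually_ball_finite) auto
      then have "\<forall>\<^sub>F k in sequentially. s \<in> ordered_times n t \<longleftrightarrow> s \<in> ordered_times n (T k)"
        by (rule eventually_mono) (simp add: ordered_times_def PiE_iff)
      \<comment> \<open>The domain is frozen first. Then either all integrands vanish at
        \<open>s\<close>, or every coordinate lies strictly between 0 and \<open>t\<close> and off
        \<open>D\<close>, where the paths converge.\<close>
      then have ev: "\<forall>\<^sub>F k in sequentially.
          indicator (ordered_times n t) s * ?f (rotate_tuple n j (\<lambda>i\<in>{..<n}. R k (s i))) =
          indicator (ordered_times n (T k)) s * ?f (rotate_tuple n j (\<lambda>i\<in>{..<n}. R k (s i)))"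
        by (rule eventually_mono) (simp add: indicator_def)
      have "(\<lambda>k. indicator (ordered_times n t) s * ?f (rotate_tuple n j (\<lambda>i\<in>{..<n}. R k (s i))))
        \<longlonglongrightarrow> indicator (ordered_times n t) s * ?f (rotate_tuple n j (\<lambda>i\<in>{..<n}. Q (s i)))"
      proof (cases "s \<in> ordered_times n t")
        case True
        have "(\<lambda>k. g i (rotate_tuple n j (\<lambda>i\<in>{..<n}. R k (s i)) i)) \<longlonglongrightarrow> g i (rotate_tuple n j (\<lambda>i\<in>{..<n}. Q (s i)) i)"
          if i: "i \<in> {..<n}" for i
        proof -
          let ?i = "(i + j) mod n"
          have i': "?i < n" using n by simp
          have "(\<lambda>k. R k (s ?i)) \<longlonglongrightarrow> Q (s ?i)"
            using True elim i' by (intro R) (auto simp: ordered_times_def PiE_iff)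
          moreover have "isCont (g i) (Q (s ?i))" using g(1)[of i] by (simp add: continuous_on_eq_continuous_at)
          ultimately have "(\<lambda>k. g i (R k (s ?i))) \<longlonglongrightarrow> g i (Q (s ?i))" by (rule isCont_tendsto_compose[rotated])
          then show ?thesis using i i' by (simp add: rotate_tuple_def)
        qed
        then show ?thesis by (intro tendsto_mult tendsto_const tendsto_prod)
      qed simp
      then show ?case using tendsto_cong[OF ev] by blast
    qed
  qed (intro hm meas)+
  then show ?thesis
    unfolding multi_occ_def set_lebesgue_integral_def real_scaleR_def fst_conv snd_conv
    by (intro tendsto_sum)
qed

text \<open>The near-optimal representative in \<open>L\<close> is a shift of the given
  \<open>(t, p)\<close> and is absorbed into \<open>a\<close>; only the representative of
  \<open>L'\<close> stays free. \<open>\<psi>\<close> is the time change of the unit interval, read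
  at the normalized time \<open>s / t'\<close>.\<close>

lemma loops_approximation:
  fixes L L' :: "'a::metric_space timed_path set"
  assumes L: "L \<in> loops" "L' \<in> loops" "(t, p) \<in> L" and e: "loop_dist L L' < e"
  obtains t' p' a \<psi> where "(t', p') \<in> L'" "\<bar>t - t'\<bar> < e" "a \<in> {0..t}"
    "\<And>s. 0 \<le> s \<Longrightarrow> s \<le> t' \<Longrightarrow> \<bar>\<psi> s - s / t'\<bar> \<le> exp e - 1"
    "\<And>s. 0 \<le> s \<Longrightarrow> s \<le> t' \<Longrightarrow> dist (p' s) (periodic_ext t p (t * \<psi> s + a)) < e"
proof -
  \<comment> \<open>A real infimum below \<open>e\<close> yields a member below \<open>e\<close>
    only for a nonempty set.\<close>
  have "L \<times> L' \<noteq> {}" using in_loops_nonempty L by blast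
  then obtain l l' where l: "l \<in> L" "l' \<in> L'" "based_loop_dist l l' < e"
    using cInf_lessD[of "(\<lambda>(l, l'). based_loop_dist l l') ` (L \<times> L')" e] e unfolding loop_dist_def by auto
  obtain t1 p1 t' p' where tp: "l = (t1, p1)" "l' = (t', p')" by (metis surj_pair)
  have b: "(t, p) \<in> based_loops" "(t1, p1) \<in> based_loops" "(t', p') \<in> based_loops"
    using L l tp in_loops_based by blast+
  obtain a where a: "a \<in> {0..<t}" "l = circ_shift a (t, p)" using in_loops_shift[OF L(1,3) l(1)] by auto
  have t1: "t1 = t" using a(2) tp by (simp add: circ_shift_def)
  have p1: "p1 u = periodic_ext t p (u + a)" if "u \<in> {0..t}" for u
    using snd_circ_shift[OF based_loop_duration_pos[OF b(1)] based_loop_endpoints[OF b(1)] a(1) that] unfolding a(2)[symmetric] tp by simp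
  have "\<bar>t - t'\<bar> + skorokhod_dist (normalized (t1, p1)) (normalized (t', p')) < e"
    using l(3) unfolding based_loop_dist_def tp t1 by simp
  then have d: "\<bar>t - t'\<bar> < e" "skorokhod_dist (normalized (t1, p1)) (normalized (t', p')) < e"
    using skorokhod_dist_nonneg[of "normalized (t1, p1)" "normalized (t', p')"] by linarith+
  obtain \<phi> where \<phi>: "\<phi> \<in> time_changes"
    "\<And>s t. 0 \<le> s \<Longrightarrow> s < t \<Longrightarrow> t \<le> 1 \<Longrightarrow> \<bar>ln ((\<phi> t - \<phi> s) / (t - s))\<bar> < e"
    "\<And>u. u \<in> {0..1} \<Longrightarrow> dist (normalized (t1, p1) (\<phi> u)) (normalized (t', p') u) < e"
    using skorokhod_dist_lessE[OF bounded_normalized[OF b(2)] bounded_normalized[OF b(3)] d(2)] by blast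
  have close: "\<phi> u \<in> {0..1}" "\<bar>\<phi> u - u\<bar> \<le> exp e - 1" if "u \<in> {0..1}" for u
    by (rule time_change_close_to_id[OF \<phi>(1) _ that], rule \<phi>(2), assumption+)+
  have t': "t' > 0" using b(3) by (rule based_loop_duration_pos)
  show ?thesis
  proof (rule that[of t' p' a "\<lambda>s. \<phi> (s / t')"])
    show "(t', p') \<in> L'" "\<bar>t - t'\<bar> < e" "a \<in> {0..t}" using l tp d a by auto
  next
    fix s :: real assume s: "0 \<le> s" "s \<le> t'"
    have u: "s / t' \<in> {0..1}" using s t' by simp
    show "\<bar>\<phi> (s / t') - s / t'\<bar> \<le> exp e - 1" by (rule close(2)[OF u])
    have \<phi>u: "\<phi> (s / t') \<in> {0..1}" by (rule close(1)[OF u])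
    then have "t * \<phi> (s / t') \<in> {0..t}" using based_loop_duration_pos[OF b(1)] by (auto simp: mult_left_le)
    then have "normalized (t1, p1) (\<phi> (s / t')) = periodic_ext t p (t * \<phi> (s / t') + a)"
      using \<phi>u p1 by (simp add: normalized_def t1)
    moreover have "normalized (t', p') (s / t') = p' s" using u t' by (simp add: normalized_def)
    ultimately show "dist (p' s) (periodic_ext t p (t * \<phi> (s / t') + a)) < e"
      using \<phi>(3)[OF u] by (simp add: dist_commute)
  qed
qed

text \<open>The shifts relating near-optimal representatives to \<open>(t, p)\<close> converge only
  along a subsequence. The argument therefore starts from counterexamples at radii
  \<open>1 / (k + 1)\<close> and contradicts their uniform gap \<open>\<epsilon>\<close>.\<close>

lemma loop_multi_occ_continuous:
  fixes g :: "nat \<Rightarrow> 'a::polish_space \<Rightarrow> real" and L :: "'a timed_path set"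
  assumes n: "n \<ge> 1"
    and g: "\<And>i. continuous_on UNIV (g i)" "\<And>i x. 0 \<le> g i x" "\<And>i x. g i x \<le> 1"
    and L: "L \<in> loops" and \<epsilon>: "\<epsilon> > 0"
  shows "\<exists>r>0. \<forall>L'\<in>loops. loop_dist L L' < r \<longrightarrow>
    \<bar>loop_multi_occ n L' (\<lambda>z. \<Prod>i<n. g i (z i)) - loop_multi_occ n L (\<lambda>z. \<Prod>i<n. g i (z i))\<bar> < \<epsilon>"
proof (rule ccontr)
  let ?f = "\<lambda>z. \<Prod>i<n. g i (z i)"
  assume neg: "\<not> ?thesis"
  have fm: "?f \<in> borel_measurable (borel_of (power_topology n))"
    using g(1) by (intro borel_measurable_prod measurable_power_component borel_measurable_continuous_onI) auto
  have f1: "\<bar>?f z\<bar> \<le> 1" for z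
    using g by (subst abs_of_nonneg) (auto intro!: prod_nonneg prod_le_1)
  define e where "e k = inverse (real (Suc k))" for k
  have e: "e k > 0" for k by (simp add: e_def)
  have e0: "e \<longlonglongrightarrow> 0" unfolding e_def by (rule LIMSEQ_inverse_real_of_nat)
  obtain t p where l: "(t, p) \<in> L" using in_loops_nonempty[OF L] by force
  have b: "(t, p) \<in> based_loops" using L l by (rule in_loops_based)
  have t: "t > 0" using b by (rule based_loop_duration_pos)
  let ?Q = "periodic_ext t p"
  have "\<exists>L'\<in>loops. loop_dist L L' < e k \<and> \<epsilon> \<le> \<bar>loop_multi_occ n L' ?f - loop_multi_occ n L ?f\<bar>" for k
    using neg e[of k] not_le by blast
  then obtain X where X: "\<And>k. X k \<in> loops" "\<And>k. loop_dist L (X k) < e k"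
    "\<And>k. \<epsilon> \<le> \<bar>loop_multi_occ n (X k) ?f - loop_multi_occ n L ?f\<bar>" by metis
  have "\<exists>t' p' a \<psi>. (t', p') \<in> X k \<and> \<bar>t - t'\<bar> < e k \<and> a \<in> {0..t} \<and>
      (\<forall>s. 0 \<le> s \<longrightarrow> s \<le> t' \<longrightarrow> \<bar>\<psi> s - s / t'\<bar> \<le> exp (e k) - 1 \<and>
        dist (p' s) (?Q (t * \<psi> s + a)) < e k)" for k
    using loops_approximation[OF L X(1) l X(2)[of k]] by metis
  then obtain t' p' a \<psi> where A: "\<And>k. (t' k, p' k) \<in> X k" "\<And>k. \<bar>t - t' k\<bar> < e k" "\<And>k. a k \<in> {0..t}"
    and B: "\<And>k s. 0 \<le> s \<Longrightarrow> s \<le> t' k \<Longrightarrow> \<bar>\<psi> k s - s / t' k\<bar> \<le> exp (e k) - 1 \<and>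
        dist (p' k s) (?Q (t * \<psi> k s + a k)) < e k"
    by metis
  obtain \<sigma> r where r: "r \<in> {0..t}" and \<sigma>: "strict_mono \<sigma>" and a: "(a \<circ> \<sigma>) \<longlonglongrightarrow> r"
    using seq_compactE[OF compact_imp_seq_compact[OF compact_Icc], of a 0 t] A(3) by metis
  have "(\<lambda>k. t' k - t) \<longlonglongrightarrow> 0"
    by (rule Lim_null_comparison[OF _ e0], rule always_eventually)
      (use A(2) in \<open>simp add: abs_minus_commute less_imp_le\<close>)
  then have "t' \<longlonglongrightarrow> t" by (rule LIM_zero_cancel)
  then have T: "(\<lambda>k. t' (\<sigma> k)) \<longlonglongrightarrow> t" using LIMSEQ_subseq_LIMSEQ[OF _ \<sigma>] by (simp add: o_def)
  have e\<sigma>: "(\<lambda>k. e (\<sigma> k)) \<longlonglongrightarrow> 0" using LIMSEQ_subseq_LIMSEQ[OF e0 \<sigma>] by (simp add: o_def)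
  have b': "(t' k, p' k) \<in> based_loops" for k using X(1) A(1) by (rule in_loops_based)
  \<comment> \<open>The discontinuity times of the limit path
    \<open>\<lambda>u. ?Q (u + r)\<close>.\<close>
  define D where "D = (\<lambda>x. x - r) ` {x. \<not> isCont ?Q x}"
  have "countable D" unfolding D_def by (intro countable_image countable_discont_periodic_ext[OF b])
  have lim: "(\<lambda>k. periodic_ext (t' (\<sigma> k)) (p' (\<sigma> k)) s) \<longlonglongrightarrow> ?Q (s + r)" if s: "0 < s" "s < t" "s \<notin> D" for s
  proof -
    \<comment> \<open>From some \<open>k\<close> on, \<open>s\<close> is an admissible time of the
      \<open>k\<close>-th loop, and its path agrees there with the periodic extension.\<close>
    have ev: "\<forall>\<^sub>F k in sequentially. s < t' (\<sigma> k)" using order_tendstoD(1)[OF T s(2)] .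
    have "(\<lambda>k. exp (e (\<sigma> k)) - 1) \<longlonglongrightarrow> exp 0 - 1" by (intro tendsto_intros e\<sigma>)
    then have "(\<lambda>k. exp (e (\<sigma> k)) - 1) \<longlonglongrightarrow> 0" by simp
    moreover have "\<forall>\<^sub>F k in sequentially. norm (\<psi> (\<sigma> k) s - s / t' (\<sigma> k)) \<le> exp (e (\<sigma> k)) - 1"
      using ev
    proof eventually_elim
      case (elim k)
      then show ?case using B[of s "\<sigma> k"] s(1) by simp
    qed
    ultimately have "(\<lambda>k. \<psi> (\<sigma> k) s - s / t' (\<sigma> k)) \<longlonglongrightarrow> 0"
      by (rule Lim_null_comparison[rotated])
    moreover have "(\<lambda>k. s / t' (\<sigma> k)) \<longlonglongrightarrow> s / t" using T t by (intro tendsto_divide tendsto_const) simp_all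
    ultimately have "(\<lambda>k. (\<psi> (\<sigma> k) s - s / t' (\<sigma> k)) + s / t' (\<sigma> k)) \<longlonglongrightarrow> 0 + s / t" by (rule tendsto_add)
    then have "(\<lambda>k. \<psi> (\<sigma> k) s) \<longlonglongrightarrow> s / t" by simp
    then have "(\<lambda>k. t * \<psi> (\<sigma> k) s + a (\<sigma> k)) \<longlonglongrightarrow> t * (s / t) + r"
      using a unfolding o_def by (intro tendsto_add tendsto_mult tendsto_const)
    then have x: "(\<lambda>k. t * \<psi> (\<sigma> k) s + a (\<sigma> k)) \<longlonglongrightarrow> s + r" using t by simp
    \<comment> \<open>The perturbed times approach \<open>s + r\<close> from no fixed side, so
      right-continuity would not suffice.\<close>
    have "isCont ?Q (s + r)" using s(3) unfolding D_def by (auto simp: image_iff dest: spec[of _ "s + r"])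
    then have "(\<lambda>k. ?Q (t * \<psi> (\<sigma> k) s + a (\<sigma> k))) \<longlonglongrightarrow> ?Q (s + r)" using x by (rule isCont_tendsto_compose)
    \<comment> \<open>The majorant in the triangle inequality: the error of the approximation plus
      the oscillation of \<open>?Q\<close> between the perturbed time and
      \<open>s + r\<close>.\<close>
    from tendsto_add[OF e\<sigma> iffD1[OF tendsto_dist_iff this]]
    have "(\<lambda>k. e (\<sigma> k) + dist (?Q (t * \<psi> (\<sigma> k) s + a (\<sigma> k))) (?Q (s + r))) \<longlonglongrightarrow> 0" by simp
    moreover have "\<forall>\<^sub>F k in sequentially. norm (dist (periodic_ext (t' (\<sigma> k)) (p' (\<sigma> k)) s) (?Q (s + r)))
        \<le> e (\<sigma> k) + dist (?Q (t * \<psi> (\<sigma> k) s + a (\<sigma> k))) (?Q (s + r))"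
      using ev
    proof eventually_elim
      case (elim k)
      have "dist (p' (\<sigma> k) s) (?Q (s + r)) \<le> dist (p' (\<sigma> k) s) (?Q (t * \<psi> (\<sigma> k) s + a (\<sigma> k))) +
          dist (?Q (t * \<psi> (\<sigma> k) s + a (\<sigma> k))) (?Q (s + r))" by (rule dist_triangle)
      also have "dist (p' (\<sigma> k) s) (?Q (t * \<psi> (\<sigma> k) s + a (\<sigma> k))) \<le> e (\<sigma> k)"
        using B[of s "\<sigma> k"] s elim by simp
      finally show ?case using s elim by (simp add: periodic_ext_eq)
    qed
    ultimately show ?thesis
      unfolding tendsto_dist_iff[of _ "?Q (s + r)"] by (rule Lim_null_comparison[rotated])
  qed
  have Qr: "(\<lambda>u. ?Q (u + r)) \<in> borel_measurable borel"
    using borel_measurable_periodic_ext[OF b] by (rule measurable_compose[rotated]) simp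
  have "(\<lambda>k. multi_occ n (t' (\<sigma> k), periodic_ext (t' (\<sigma> k)) (p' (\<sigma> k))) ?f)
      \<longlonglongrightarrow> multi_occ n (t, \<lambda>u. ?Q (u + r)) ?f"
    by (rule multi_occ_tendsto[OF n g T borel_measurable_periodic_ext[OF b'] Qr \<open>countable D\<close> lim])
  also have "multi_occ n (t, \<lambda>u. ?Q (u + r)) ?f = multi_occ n (t, p) ?f"
    by (rule multi_occ_shifted_ext[OF n b r fm f1])
  also have "\<dots> = loop_multi_occ n L ?f" by (rule loop_multi_occ_eq[OF n L l fm f1, symmetric])
  also have "(\<lambda>k. multi_occ n (t' (\<sigma> k), periodic_ext (t' (\<sigma> k)) (p' (\<sigma> k))) ?f) =
      (\<lambda>k. loop_multi_occ n (X (\<sigma> k)) ?f)"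
    by (rule ext) (simp only: multi_occ_periodic_ext loop_multi_occ_eq[OF n X(1) A(1) fm f1])
  finally have "(\<lambda>k. loop_multi_occ n (X (\<sigma> k)) ?f) \<longlonglongrightarrow> loop_multi_occ n L ?f" .
  then have "\<forall>\<^sub>F k in sequentially. dist (loop_multi_occ n (X (\<sigma> k)) ?f) (loop_multi_occ n L ?f) < \<epsilon>"
    using \<epsilon> by (rule tendstoD)
  then obtain k where "dist (loop_multi_occ n (X (\<sigma> k)) ?f) (loop_multi_occ n L ?f) < \<epsilon>"
    using eventually_happens'[OF sequentially_bot] by blast
  then show False using X(3)[of "\<sigma> k"] by (simp add: dist_real_def)
qed

section \<open>From continuity to Borel measurability\<close>

lemma borel_measurable_dist_topology:
  fixes F :: "'a \<Rightarrow> real"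
  assumes "\<And>x \<epsilon>. x \<in> M \<Longrightarrow> \<epsilon> > 0 \<Longrightarrow> \<exists>r>0. \<forall>y\<in>M. d x y < r \<longrightarrow> \<bar>F y - F x\<bar> < \<epsilon>"
  shows "F \<in> borel_measurable (borel_of (dist_topology M d))"
proof (rule borel_measurableI)
  fix S :: "real set" assume S: "open S"
  have "openin (dist_topology M d) (F -` S \<inter> M)"
    unfolding openin_dist_topology
  proof (intro conjI ballI)
    fix x assume x: "x \<in> F -` S \<inter> M"
    then obtain \<epsilon> where \<epsilon>: "\<epsilon> > 0" "\<And>y. dist y (F x) < \<epsilon> \<Longrightarrow> y \<in> S"
      using S unfolding open_dist by blast
    obtain r where "r > 0" "\<forall>y\<in>M. d x y < r \<longrightarrow> \<bar>F y - F x\<bar> < \<epsilon>" using assms[of x \<epsilon>] x \<epsilon>(1) by blast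
    then show "\<exists>r>0. {y \<in> M. d x y < r} \<subseteq> F -` S \<inter> M"
      using \<epsilon>(2) by (intro exI[of _ r]) (auto simp: dist_real_def)
  qed simp
  then show "F -` S \<inter> space (borel_of (dist_topology M d)) \<in> sets (borel_of (dist_topology M d))"
    by (simp add: sets_borel_of space_borel_of topspace_dist_topology sigma_sets.Basic)
qed

theorem proposition3:
  fixes f :: "(nat \<Rightarrow> 'a::polish_space) \<Rightarrow> real" and n :: nat
  assumes "n \<ge> 1"
    and "f \<in> borel_measurable (borel_of (power_topology n))"
    and "bounded (f ` topspace (power_topology n))"
  shows "(\<lambda>L. loop_multi_occ n L f) \<in> borel_measurable (borel_of loop_topology)"
proof -
  let ?R = "borel_of (loop_topology :: 'a timed_path set topology)" and ?N = "borel_of (power_topology n) :: (nat \<Rightarrow> 'a) measure"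
  have R: "space ?R = loops" by (simp add: space_borel_of loop_topology_def topspace_dist_topology)
  \<comment> \<open>One measure per loop serves all \<open>f\<close>; what remains is measurability
    in \<open>L\<close> of integrals against a kernel.\<close>
  obtain \<kappa> where \<kappa>: "\<And>L. L \<in> loops \<Longrightarrow> finite_measure (\<kappa> L)" "\<And>L. L \<in> loops \<Longrightarrow> sets (\<kappa> L) = sets ?N"
    and int: "\<And>L f C. L \<in> loops \<Longrightarrow> f \<in> borel_measurable ?N \<Longrightarrow>
      (\<And>z. z \<in> topspace (power_topology n) \<Longrightarrow> \<bar>f z\<bar> \<le> C) \<Longrightarrow> loop_multi_occ n L f = (\<integral>z. f z \<partial>\<kappa> L)"
    using loop_multi_occ_as_integral[OF assms(1), where 'a = 'a] by metis
  have sp: "space (\<kappa> L) = PiE {..<n} (\<lambda>_. UNIV)" if "L \<in> loops" for L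
    using sets_eq_imp_space_eq[OF \<kappa>(2)[OF that]] by (simp add: space_borel_of topspace_power_topology)
  \<comment> \<open>The indicator of a box factorizes over the coordinates. Approximating each
    factor exhibits the measure of the box as a pointwise limit of continuous functions of the
    loop.\<close>
  have box: "(\<lambda>L. measure (\<kappa> L) A) \<in> borel_measurable ?R" if box: "A \<in> open_boxes n" for A
  proof -
    obtain U where U: "A = PiE {..<n} U" "\<And>i. open (U i)" using box unfolding open_boxes_def by blast
    have "\<exists>h. (\<forall>k. continuous_on UNIV (h k)) \<and> (\<forall>k x. 0 \<le> h k x) \<and> (\<forall>k x. h k x \<le> 1) \<and>
        (\<forall>x. (\<lambda>k. h k x) \<longlonglongrightarrow> (indicator (U i) x :: real))" for i
      using open_indicator_limit[OF U(2)[of i]] by metis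
    then obtain h where h: "\<And>i k. continuous_on UNIV (h i k)" "\<And>i k x. 0 \<le> h i k x" "\<And>i k x. h i k x \<le> 1"
        "\<And>i x. (\<lambda>k. h i k x) \<longlonglongrightarrow> (indicator (U i) x :: real)" by metis
    let ?f = "\<lambda>k z. \<Prod>i<n. h i k (z i)"
    have fm: "?f k \<in> borel_measurable ?N" for k
      using h(1) by (intro borel_measurable_prod measurable_power_component borel_measurable_continuous_onI) auto
    have f1: "\<bar>?f k z\<bar> \<le> 1" for k z
      using h by (subst abs_of_nonneg) (auto intro!: prod_nonneg prod_le_1)
    have "(\<lambda>k. loop_multi_occ n L (?f k)) \<longlonglongrightarrow> measure (\<kappa> L) A" if L: "L \<in> loops" for L
    proof -
      interpret finite_measure "\<kappa> L" using \<kappa>(1)[OF L] .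
      have meq: "borel_measurable (\<kappa> L) = (borel_measurable ?N :: _ set)"
        by (rule measurable_cong_sets[OF \<kappa>(2)[OF L] refl])
      have A: "A \<in> sets (\<kappa> L)"
        using box \<kappa>(2)[OF L] by (simp add: sets_borel_of_power_topology sigma_sets.Basic)
      have "(\<lambda>k. \<integral>z. ?f k z \<partial>\<kappa> L) \<longlonglongrightarrow> (\<integral>z. indicator A z \<partial>\<kappa> L)"
      proof (rule integral_dominated_convergence[where w = "\<lambda>_. 1"])
        show "AE z in \<kappa> L. (\<lambda>k. ?f k z) \<longlonglongrightarrow> indicator A z"
        proof (rule AE_I2)
          fix z assume "z \<in> space (\<kappa> L)"
          \<comment> \<open>\<open>PiE\<close> also demands \<open>undefined\<close> outside
            \<open>{..<n}\<close>, which the product on the right cannot see; membership in the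
            space of \<open>\<kappa> L\<close> supplies it.\<close>
          then have "indicator A z = (\<Prod>i<n. indicator (U i) (z i) :: real)"
            unfolding sp[OF L] U(1) by (auto simp: indicator_def PiE_iff)
          then show "(\<lambda>k. ?f k z) \<longlonglongrightarrow> indicator A z" using h(4) by (simp add: tendsto_prod)
        qed
        show "AE z in \<kappa> L. norm (?f k z) \<le> 1" for k using f1 by simp
      qed (use A fm meq in auto)
      moreover have "(\<integral>z. indicator A z \<partial>\<kappa> L) = measure (\<kappa> L) A"
        using sets.sets_into_space[OF A] by (simp add: Int_absorb2)
      moreover have "(\<integral>z. ?f k z \<partial>\<kappa> L) = loop_multi_occ n L (?f k)" for k
        by (rule int[OF L fm f1, symmetric])
      ultimately show ?thesis by simp
    qed
    moreover have "(\<lambda>L. loop_multi_occ n L (?f k)) \<in> borel_measurable ?R" for k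
      unfolding loop_topology_def
      by (intro borel_measurable_dist_topology loop_multi_occ_continuous assms(1) h)
    ultimately show ?thesis unfolding R[symmetric] by (rule borel_measurable_LIMSEQ_real)
  qed
  obtain C where C: "\<And>z. z \<in> topspace (power_topology n) \<Longrightarrow> \<bar>f z\<bar> \<le> C"
    using assms(3) unfolding bounded_iff by auto
  have full: "PiE {..<n} (\<lambda>_. UNIV) \<in> (open_boxes n :: (nat \<Rightarrow> 'a) set set)"
    unfolding open_boxes_def by blast
  have "(\<lambda>L. \<integral>z. f z \<partial>\<kappa> L) \<in> borel_measurable ?R"
  proof (rule borel_measurable_integral_kernel[OF Int_stable_open_boxes open_boxes_Pow full])
    show "finite_measure (\<kappa> L)" if "L \<in> space ?R" for L using \<kappa>(1) that R by blast
    show "sets (\<kappa> L) = sigma_sets (PiE {..<n} (\<lambda>_. UNIV)) (open_boxes n)" if "L \<in> space ?R" for L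
      using \<kappa>(2) that R by (simp add: sets_borel_of_power_topology)
    show "f \<in> borel_measurable (sigma (PiE {..<n} (\<lambda>_. UNIV)) (open_boxes n))"
      using assms(2) unfolding borel_measurable_borel_of_eq .
    show "\<bar>f z\<bar> \<le> C" if "z \<in> PiE {..<n} (\<lambda>_. UNIV)" for z
      using C that by (simp add: topspace_power_topology)
  qed (rule box)
  then show ?thesis
    using int[OF _ assms(2) C] by (subst measurable_cong[of ?R]) (simp_all add: R)
qed

end
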